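(* Let $\ell$ be a prime number and let $q \ge 2$ be an odd positive integer. Let $S=\{s_1,\ldots,s_t\}$ be a finite set of integers of cardinality $t=(q+1)/2$ and let $i:S\to\mathbb{Z}$ be a function. For $j=1,\ldots,t$ put $a_j=i(s_j)$ and $b_j=|a_j|$, and assume that at least one of $a_1,\ldots,a_t$ is relatively prime to $\ell$. For $n\ge 1$ let $i_n:S\to\mathbb{Z}/\ell^n\mathbb{Z}$ be the composition of $i$ with reduction modulo $\ell^n$, and consider the regular abelian $\ell$-tower $$X=B_t\longleftarrow X(\mathbb{Z}/\ell\mathbb{Z},S,i_1)\longleftarrow X(\mathbb{Z}/\ell^2\mathbb{Z},S,i_2)\longleftarrow\cdots\longleftarrow X(\mathbb{Z}/\ell^n\mathbb{Z},S,i_n)\longleftarrow\cdots$$ Let $\kappa_n$ be the number of spanning trees of $X(\mathbb{Z}/\ell^n\mathbb{Z},S,i_n)$. Define integers $c_1,\ldots,c_a$ by $$Q(T)=P_{b_1}(T)+\cdots+P_{b_t}(T)=c_1T+\cdots+c_aT^a ,$$ and set $$\mu_\ell=\min\{\mathrm{ord}_\ell(c_j)\mid j=1,\ldots,a\},\qquad \lambda_\ell=\min\{2j\mid j=1,\ldots,a\text{ and }\mathrm{ord}_\ell(c_j)=\mu_\ell\}-1 .$$ Then there exist an integer $n_0\ge 1$ and a constant $\nu_\ell$ (depending also on the $a_j$) such that $$\mathrm{ord}_\ell(\kappa_n)=\mu_\ell\cdot\ell^n+\lambda_\ell\cdot n+\nu_\ell$$ for all $n\ge n_0$.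
   Context: Multigraphs may have loops and multiple edges. $B_t$ is the bouquet: one vertex with $t$ loops. For a finite abelian group $G$ (written additively), a finite set $S$ and a function $i:S\to G$, the Cayley-Serre multigraph $X(G,S,i)$ is the undirected multigraph with vertex set $\{v_\sigma\mid\sigma\in G\}$ and edge set $\{(\sigma,s)\mid \sigma\in G,\ s\in S\}$, where the (undirected) edge $(\sigma,s)$ connects $v_\sigma$ to $v_{\sigma+i(s)}$. It is connected if and only if $i(S)$ generates $G$; the hypothesis that some $a_j$ is prime to $\ell$ guarantees connectedness of all the multigraphs in the tower. The maps in the tower are the natural ones, induced by the reduction maps on the groups $\mathbb{Z}/\ell^n\mathbb{Z}$. The polynomials $P_a(T)\in\mathbb{Z}[T]$ ($a\ge 0$) are defined recursively by $P_0(T)=0$, $P_1(T)=T$, and for $a\ge 2$ $$P_a(T)=T\bigl(a^2-(a-1)P_1(T)-(a-2)P_2(T)-\cdots-P_{a-1}(T)\bigr).$$ $\mathrm{ord}_\ell$ is the usual $\ell$-adic valuation, with $\mathrm{ord}_\ell(0)=\infty$. *)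

theory Defs
  imports
    "HOL-Algebra.Elementary_Groups"
    "HOL-Computational_Algebra.Computational_Algebra"
    "HOL-Library.Extended_Real"
begin

text \<open>Undirected multigraphs with loops and multiple edges: \<open>ends e\<close> is the set of
  endpoints of the edge \<open>e\<close>, a singleton if and only if \<open>e\<close> is a loop.\<close>

record ('v, 'e) multigraph =
  verts :: "'v set"
  edges :: "'e set"
  ends :: "'e \<Rightarrow> 'v set"

definition walk :: "('v, 'e) multigraph \<Rightarrow> 'v list \<Rightarrow> 'e list \<Rightarrow> bool" where
  "walk X vs es \<longleftrightarrow>
     length vs = Suc (length es) \<and> set vs \<subseteq> verts X \<and> set es \<subseteq> edges X \<and>
     (\<forall>k < length es. ends X (es ! k) = {vs ! k, vs ! Suc k})"

definition connected_multigraph :: "('v, 'e) multigraph \<Rightarrow> bool" where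
  "connected_multigraph X \<longleftrightarrow>
     verts X \<noteq> {} \<and>
     (\<forall>u \<in> verts X. \<forall>v \<in> verts X. \<exists>vs es. walk X vs es \<and> hd vs = u \<and> last vs = v)"

text \<open>A loop is a cycle of length 1 and a pair of parallel edges gives a cycle of length 2;
  distinctness of the edges excludes walking back and forth along one edge.\<close>

definition is_cycle :: "('v, 'e) multigraph \<Rightarrow> 'v list \<Rightarrow> 'e list \<Rightarrow> bool" where
  "is_cycle X vs es \<longleftrightarrow>
     walk X vs es \<and> es \<noteq> [] \<and> hd vs = last vs \<and> distinct (tl vs) \<and> distinct es"

definition is_tree :: "('v, 'e) multigraph \<Rightarrow> bool" where
  "is_tree X \<longleftrightarrow> connected_multigraph X \<and> (\<nexists>vs es. is_cycle X vs es)"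

text \<open>A spanning tree contains all vertices, so it is determined by its set of edges.\<close>

definition spanning_trees :: "('v, 'e) multigraph \<Rightarrow> 'e set set" where
  "spanning_trees X = {F. F \<subseteq> edges X \<and> is_tree (X\<lparr>edges := F\<rparr>)}"

definition cayley_serre ::
    "('g, 'm) monoid_scheme \<Rightarrow> 's set \<Rightarrow> ('s \<Rightarrow> 'g) \<Rightarrow> ('g, 'g \<times> 's) multigraph" where
  "cayley_serre G S i =
     \<lparr>verts = carrier G, edges = carrier G \<times> S,
      ends = (\<lambda>(\<sigma>, s). {\<sigma>, \<sigma> \<otimes>\<^bsub>G\<^esub> i s})\<rparr>"

function P :: "nat \<Rightarrow> int poly" where
  "P a = (if a = 0 then 0 else if a = 1 then [:0, 1:]
          else [:0, 1:] * (of_nat (a^2) - (\<Sum>k = 1..<a. of_nat (a - k) * P k)))"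
  by pat_completeness auto
termination by (relation "Wellfounded.measure id") auto

declare P.simps [simp del]

definition ord_at :: "nat \<Rightarrow> int \<Rightarrow> ereal" where
  "ord_at l x = (if x = 0 then \<infinity> else ereal (real (multiplicity (int l) x)))"

end

theory Submission
  imports Defs "Jordan_Normal_Form.Char_Poly" "HOL-Number_Theory.Cong"
begin

text \<open>By the matrix-tree theorem and the diagonalisation of circulant matrices, \<open>l\<^sup>n \<kappa>\<^sub>n\<close> is the
  product of \<open>Q(2 - z - 1/z)\<close> over the \<open>l\<^sup>n\<close>-th roots of unity \<open>z \<noteq> 1\<close>, because
  \<open>P\<^sub>a(2 - z - 1/z) = 2 - z\<^sup>a - z\<^sup>-\<^sup>a\<close>. Passing from level \<open>n\<close> to \<open>n + 1\<close> adds the factors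
  belonging to the primitive roots, of which there are \<open>(l - 1) l\<^sup>n\<close>. At such a root \<open>T = 2 - z - 1/z\<close>
  equals \<open>(z - 1)\<^sup>2\<close> up to a unit, and \<open>l\<close> is a unit times a high power of \<open>z - 1\<close>. Hence for large \<open>n\<close> the
  first term of \<open>l\<^sup>-\<^sup>\<mu> Q(T)\<close> whose coefficient \<open>c\<^sub>j\<close> is prime to \<open>l\<close> dominates, and since the product of
  the \<open>T\<close> is \<open>l\<^sup>2\<close>, the new factors have valuation \<open>\<mu> (l - 1) l\<^sup>n + 2 j\<close>. Units are recognised
  without algebraic number theory: the product of \<open>F(z)\<close> over all \<open>l\<^sup>n\<close>-th roots of unity is the
  determinant of an integer circulant matrix, and it is prime to \<open>l\<close> as soon as \<open>F(1)\<close> is.\<close>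

section \<open>Spanning trees and cuts\<close>

definition crosses :: "('v, 'e) multigraph \<Rightarrow> 'v set \<Rightarrow> 'e \<Rightarrow> bool" where
  "crosses X W e \<longleftrightarrow> ends X e \<inter> W \<noteq> {} \<and> ends X e - W \<noteq> {}"

text \<open>This is connectivity after contracting \<open>R\<close> to a point, phrased by cuts
  instead of walks. In this form contracting an edge from \<open>R\<close> to \<open>v\<close> only
  means replacing \<open>R\<close> by \<open>insert v R\<close>.\<close>

definition cut_connected :: "('v, 'e) multigraph \<Rightarrow> 'v set \<Rightarrow> 'e set \<Rightarrow> bool" where
  "cut_connected X R F \<longleftrightarrow>
     (\<forall>W. R \<subseteq> W \<and> W \<subset> verts X \<longrightarrow> (\<exists>e\<in>F. crosses X W e))"

text \<open>For \<open>R\<close> inside the vertex set these are the spanning trees of the graph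
  with \<open>R\<close> contracted to a point. The number of edges takes the place of acyclicity, so
  that no cycles enter the counting argument.\<close>

definition rooted_forests :: "('v, 'e) multigraph \<Rightarrow> 'e set \<Rightarrow> 'v set \<Rightarrow> 'e set set" where
  "rooted_forests X E R = {F. F \<subseteq> E \<and> cut_connected X R F \<and> card F = card (verts X - R)}"

text \<open>Discrete intermediate value principle: a sequence with ends on different sides of
  \<open>W\<close> changes sides at some step.\<close>

lemma walk_changes:
  assumes "(vs ! i \<in> W) \<noteq> (vs ! j \<in> W)" "i \<le> j"
  shows "\<exists>k. i \<le> k \<and> k < j \<and> (vs ! k \<in> W) \<noteq> (vs ! Suc k \<in> W)"
proof (rule ccontr)
  assume c: "\<not> ?thesis"
  have "i + d \<le> j \<longrightarrow> (vs ! (i + d) \<in> W) = (vs ! i \<in> W)" for d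
    using c by (induction d) auto
  from this[of "j - i"] show False using assms by simp
qed

locale finite_multigraph =
  fixes X :: "('v, 'e) multigraph"
  assumes finite_verts: "finite (verts X)" and finite_edges: "finite (edges X)"
    and ends_sub: "e \<in> edges X \<Longrightarrow> ends X e \<subseteq> verts X"
    and ends_pair: "e \<in> edges X \<Longrightarrow> \<exists>x y. ends X e = {x, y}"
begin

lemma crosses_pair:
  assumes "ends X e = {x, y}"
  shows "crosses X W e \<longleftrightarrow> (x \<in> W) \<noteq> (y \<in> W)"
  unfolding crosses_def assms by auto

text \<open>Among the sets \<open>W\<close> containing \<open>R\<close>, the edge \<open>e\<close>
  crosses exactly those that miss \<open>v\<close>. The remaining edges only have to take care of
  the sets containing \<open>v\<close>.\<close>

lemma cut_connected_insert:
  assumes "ends X e = {r, v}" "r \<in> R" "v \<notin> R"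
  shows "cut_connected X R (insert e F) \<longleftrightarrow> cut_connected X (insert v R) F"
  unfolding cut_connected_def
proof (intro iffI allI impI)
  fix W assume L: "\<forall>W. R \<subseteq> W \<and> W \<subset> verts X \<longrightarrow> (\<exists>e\<in>insert e F. crosses X W e)"
    and W: "insert v R \<subseteq> W \<and> W \<subset> verts X"
  have "\<not> crosses X W e" using crosses_pair[OF assms(1)] W assms(2) by auto
  moreover have "\<exists>e\<in>insert e F. crosses X W e" using L W by auto
  ultimately show "\<exists>e\<in>F. crosses X W e" by auto
next
  fix W assume L: "\<forall>W. insert v R \<subseteq> W \<and> W \<subset> verts X \<longrightarrow> (\<exists>e\<in>F. crosses X W e)"
    and W: "R \<subseteq> W \<and> W \<subset> verts X"
  show "\<exists>e\<in>insert e F. crosses X W e"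
  proof (cases "v \<in> W")
    case True
    then show ?thesis using L W by simp
  next
    case False
    then have "crosses X W e" using crosses_pair[OF assms(1)] W assms(2) by auto
    then show ?thesis by simp
  qed
qed

lemma crossing_edge:
  assumes "cut_connected X R F" "F \<subseteq> edges X" "R \<subset> verts X"
  obtains e r v where "e \<in> F" "ends X e = {r, v}" "r \<in> R" "v \<notin> R" "v \<in> verts X"
proof -
  from assms obtain e where e: "e \<in> F" "crosses X R e"
    unfolding cut_connected_def by (meson order_refl)
  from e(1) assms(2) obtain x y where xy: "ends X e = {x, y}" using ends_pair by blast
  have "ends X e \<subseteq> verts X" using e(1) assms(2) ends_sub by blast
  then show thesis
    using e that[of e x y] that[of e y x] xy crosses_pair[OF xy] by (auto simp: insert_commute)
qed

text \<open>Greedy growth as in Prim's algorithm: a crossing edge at \<open>R\<close> brings in one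
  new vertex, and the rest is found with that vertex added to \<open>R\<close>. One edge is spent
  per vertex outside \<open>R\<close>.\<close>

lemma rooted_forest_exists:
  assumes "cut_connected X R F" "F \<subseteq> edges X" "R \<subseteq> verts X"
  shows "\<exists>F'. F' \<in> rooted_forests X F R"
  using assms
proof (induction "card (verts X - R)" arbitrary: F R)
  case 0
  then have "verts X = R" using finite_verts by auto
  then have "{} \<in> rooted_forests X F R" unfolding rooted_forests_def cut_connected_def by auto
  then show ?case by blast
next
  case (Suc k)
  then have "R \<subset> verts X" by (metis Diff_cancel card.empty nat.distinct(1) psubsetI)
  from crossing_edge[OF Suc.prems(1,2) this] obtain e r v where
    e: "e \<in> F" "ends X e = {r, v}" "r \<in> R" "v \<notin> R" "v \<in> verts X" .
  have eF: "insert e (F - {e}) = F" using e(1) by blast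
  have "cut_connected X (insert v R) (F - {e})"
    using cut_connected_insert[OF e(2-4), of "F - {e}"] Suc.prems(1) unfolding eF by blast
  moreover have c: "verts X - insert v R = (verts X - R) - {v}" by blast
  moreover have k: "k = card (verts X - insert v R)"
    unfolding c using Suc.hyps(2) e(4,5) finite_verts by simp
  ultimately obtain F' where F': "F' \<in> rooted_forests X (F - {e}) (insert v R)"
    using Suc.hyps(1)[of "insert v R" "F - {e}"] Suc.prems e by blast
  have "finite F'" using F' Suc.prems(2) finite_edges unfolding rooted_forests_def
    by (auto intro: finite_subset)
  moreover have "e \<notin> F'" using F' unfolding rooted_forests_def by auto
  ultimately have "insert e F' \<in> rooted_forests X F R"
    using F' e(1) k Suc.hyps(2) cut_connected_insert[OF e(2-4), of F']
    unfolding rooted_forests_def by auto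
  then show ?case by blast
qed

lemma card_le_of_cut_connected:
  assumes "cut_connected X R F" "F \<subseteq> edges X" "R \<subseteq> verts X"
  shows "card (verts X - R) \<le> card F"
proof -
  obtain F' where "F' \<in> rooted_forests X F R" using rooted_forest_exists[OF assms] by blast
  then show ?thesis
    using card_mono[of F F'] finite_subset[OF assms(2) finite_edges]
    unfolding rooted_forests_def by auto
qed

text \<open>A set and its complement are crossed by the same edges, so a cut missing
  \<open>r\<close> may be replaced by one containing it.\<close>

lemma cut_connected_root:
  assumes "cut_connected X {r} F" "F \<subseteq> edges X" "r \<in> verts X"
  shows "cut_connected X {u} F"
  unfolding cut_connected_def
proof (intro allI impI)
  fix W assume W: "{u} \<subseteq> W \<and> W \<subset> verts X"
  show "\<exists>e\<in>F. crosses X W e"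
  proof (cases "r \<in> W")
    case True
    then show ?thesis using W assms(1) unfolding cut_connected_def by simp
  next
    case False
    then have "{r} \<subseteq> verts X - W \<and> verts X - W \<subset> verts X" using W assms(3) by auto
    then obtain e where e: "e \<in> F" "crosses X (verts X - W) e"
      using assms(1) unfolding cut_connected_def by meson
    moreover have "ends X e \<subseteq> verts X" using e(1) assms(2) ends_sub by blast
    ultimately have "crosses X W e" unfolding crosses_def by blast
    then show ?thesis using e(1) by auto
  qed
qed

text \<open>If the set \<open>W\<close> of vertices reachable from \<open>u\<close> by simple walks
  were proper, an edge of \<open>F\<close> would leave it, and its outer end would be reachable as
  well.\<close>

lemma simple_walk_exists:
  assumes "cut_connected X {u} F" "F \<subseteq> edges X" "u \<in> verts X" "v \<in> verts X"
  obtains vs es where "walk (X\<lparr>edges := F\<rparr>) vs es" "hd vs = u" "last vs = v" "distinct vs"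
proof -
  define sw where "sw v vs es \<longleftrightarrow> walk (X\<lparr>edges := F\<rparr>) vs es \<and> hd vs = u \<and> last vs = v \<and> distinct vs"
    for v vs es
  define W where "W = {v \<in> verts X. \<exists>vs es. sw v vs es}"
  have "sw u [u] []" using assms unfolding walk_def sw_def by simp
  then have u: "u \<in> W" using assms(3) unfolding W_def by blast
  have sub: "W \<subseteq> verts X" unfolding W_def by simp
  have "W = verts X"
  proof (rule ccontr)
    assume "W \<noteq> verts X"
    then have lt: "W \<subset> verts X" using sub by simp
    have "cut_connected X W F" using assms(1) u unfolding cut_connected_def
      by (metis empty_subsetI insert_subset subset_trans)
    then obtain e x y where e: "e \<in> F" "ends X e = {x, y}" "x \<in> W" "y \<notin> W" "y \<in> verts X"
      by (rule crossing_edge[OF _ assms(2) lt])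
    from e(3) obtain vs es where "sw x vs es" unfolding W_def by auto
    then have w: "length vs = Suc (length es)" "set vs \<subseteq> verts X" "set es \<subseteq> F"
        "\<forall>k < length es. ends X (es ! k) = {vs ! k, vs ! Suc k}"
      and h: "hd vs = u" "last vs = x" "distinct vs"
      unfolding walk_def sw_def by auto
    have ne: "vs \<noteq> []" using w(1) by auto
    have "\<exists>vs es. sw y vs es"
    \<comment> \<open>Appending \<open>e\<close> would repeat a vertex if \<open>y\<close> already
      lies on the walk; in that case an initial segment ends at \<open>y\<close>.\<close>
    proof (cases "y \<in> set vs")
      case True
      then obtain k where k: "k < length vs" "vs ! k = y" unfolding in_set_conv_nth by blast
      have "set (take (Suc k) vs) \<subseteq> verts X" "set (take k es) \<subseteq> F"
        using w(2,3) set_take_subset by fast+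
      then have "walk (X\<lparr>edges := F\<rparr>) (take (Suc k) vs) (take k es)"
        using w(1,4) k unfolding walk_def by simp
      moreover have "last (take (Suc k) vs) = y"
        using k by (simp add: take_Suc_conv_app_nth)
      ultimately have "sw y (take (Suc k) vs) (take k es)"
        using h distinct_take unfolding sw_def by simp
      then show ?thesis by blast
    next
      case False
      have x: "x = vs ! length es" using h(2) w(1) ne by (simp add: last_conv_nth)
      have "ends X ((es @ [e]) ! k) = {(vs @ [y]) ! k, (vs @ [y]) ! Suc k}"
        if "k < Suc (length es)" for k
        using that w(1,4) e(2) x by (cases "k = length es") (simp_all add: nth_append)
      then have "walk (X\<lparr>edges := F\<rparr>) (vs @ [y]) (es @ [e])"
        using w e(1,5) unfolding walk_def by simp
      then have "sw y (vs @ [y]) (es @ [e])" unfolding sw_def using h ne False by simp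
      then show ?thesis by blast
    qed
    then show False using e unfolding W_def by simp
  qed
  then show thesis using assms(4) that unfolding W_def sw_def by blast
qed

text \<open>If the first edge of a cycle crosses a cut, the rest of the cycle has to return to the
  side where it started. So another edge of the cycle crosses the same cut, and the first one can be
  spared.\<close>

lemma cut_connected_removable:
  assumes "cut_connected X {r} F" "F \<subseteq> edges X" "is_cycle (X\<lparr>edges := F\<rparr>) vs es"
  shows "es ! 0 \<in> F" "cut_connected X {r} (F - {es ! 0})"
proof -
  have c: "length vs = Suc (length es)" "set es \<subseteq> F" "es \<noteq> []" "hd vs = last vs" "distinct es"
      "\<forall>k < length es. ends X (es ! k) = {vs ! k, vs ! Suc k}"
    using assms(3) unfolding is_cycle_def walk_def by auto
  have len: "0 < length es" using c(3) by simp
  have F: "es ! k \<in> F" if "k < length es" for k using c(2) nth_mem[OF that] by blast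
  show "es ! 0 \<in> F" using F[OF len] .
  have "vs \<noteq> []" using c(1) by auto
  then have closed: "vs ! 0 = vs ! length es" using c(1,4) by (simp add: hd_conv_nth last_conv_nth)
  show "cut_connected X {r} (F - {es ! 0})"
    unfolding cut_connected_def
  proof (intro allI impI)
    fix W assume "{r} \<subseteq> W \<and> W \<subset> verts X"
    then obtain e where e: "e \<in> F" "crosses X W e" using assms(1) unfolding cut_connected_def by meson
    show "\<exists>e\<in>F - {es ! 0}. crosses X W e"
    proof (cases "e = es ! 0")
      case True
      then have "(vs ! 0 \<in> W) \<noteq> (vs ! 1 \<in> W)"
        using e(2) crosses_pair[of "es ! 0"] c(6) len by simp
      then have "(vs ! 1 \<in> W) \<noteq> (vs ! length es \<in> W)" using closed by simp
      then have "\<exists>k. 1 \<le> k \<and> k < length es \<and> (vs ! k \<in> W) \<noteq> (vs ! Suc k \<in> W)"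
        using walk_changes[of vs 1 W "length es"] len by simp
      then obtain k where k: "1 \<le> k" "k < length es" "(vs ! k \<in> W) \<noteq> (vs ! Suc k \<in> W)" by blast
      then have "crosses X W (es ! k)" using crosses_pair[of "es ! k"] c(6) by simp
      moreover have "es ! k \<noteq> es ! 0" using c(5) k(1,2) len by (simp add: nth_eq_iff_index_eq)
      ultimately show ?thesis using F[OF k(2)] by (intro bexI[of _ "es ! k"]) simp_all
    next
      case False
      then show ?thesis using e by (intro bexI[of _ e]) simp_all
    qed
  qed
qed

lemma connected_multigraph_iff:
  assumes "F \<subseteq> edges X" "r \<in> verts X"
  shows "connected_multigraph (X\<lparr>edges := F\<rparr>) \<longleftrightarrow> cut_connected X {r} F"
proof
  assume L: "connected_multigraph (X\<lparr>edges := F\<rparr>)"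
  show "cut_connected X {r} F"
    unfolding cut_connected_def
  proof (intro allI impI)
    fix W assume W: "{r} \<subseteq> W \<and> W \<subset> verts X"
    then obtain v where v: "v \<in> verts X" "v \<notin> W" by blast
    have "\<forall>u\<in>verts X. \<forall>v\<in>verts X. \<exists>vs es. walk (X\<lparr>edges := F\<rparr>) vs es \<and> hd vs = u \<and> last vs = v"
      using L unfolding connected_multigraph_def by simp
    then obtain vs es where w: "walk (X\<lparr>edges := F\<rparr>) vs es" "hd vs = r" "last vs = v"
      using assms(2) v(1) by blast
    have c: "length vs = Suc (length es)" "set es \<subseteq> F"
        "\<forall>k < length es. ends X (es ! k) = {vs ! k, vs ! Suc k}"
      using w(1) unfolding walk_def by auto
    have "vs \<noteq> []" using c(1) by auto
    then have "vs ! 0 = r" "vs ! length es = v"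
      using w(2,3) c(1) by (simp_all add: hd_conv_nth last_conv_nth)
    then have "\<exists>k. 0 \<le> k \<and> k < length es \<and> (vs ! k \<in> W) \<noteq> (vs ! Suc k \<in> W)"
      using walk_changes[of vs 0 W "length es"] W v by simp
    then obtain k where k: "k < length es" "(vs ! k \<in> W) \<noteq> (vs ! Suc k \<in> W)" by blast
    then have "crosses X W (es ! k)" using crosses_pair[of "es ! k"] c(3) by simp
    then show "\<exists>e\<in>F. crosses X W e" using c(2) nth_mem[OF k(1)] by (meson subsetD)
  qed
next
  assume R: "cut_connected X {r} F"
  have "\<exists>vs es. walk (X\<lparr>edges := F\<rparr>) vs es \<and> hd vs = u \<and> last vs = v"
    if "u \<in> verts X" "v \<in> verts X" for u v
    using simple_walk_exists[OF cut_connected_root[OF R assms, of u] assms(1) that] by blast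
  then show "connected_multigraph (X\<lparr>edges := F\<rparr>)"
    using assms(2) unfolding connected_multigraph_def by auto
qed

text \<open>The edge \<open>e\<close> closes a simple walk in \<open>F'\<close> between its ends. A
  loop is covered too: the walk then has no edges.\<close>

lemma cycle_exists:
  assumes "cut_connected X {r} F'" "F' \<subseteq> F" "F \<subseteq> edges X" "r \<in> verts X" "e \<in> F" "e \<notin> F'"
  shows "\<exists>vs es. is_cycle (X\<lparr>edges := F\<rparr>) vs es"
proof -
  have F': "F' \<subseteq> edges X" using assms(2,3) by blast
  obtain x y where xy: "ends X e = {x, y}" using ends_pair assms(3,5) by blast
  have xyV: "x \<in> verts X" "y \<in> verts X" using ends_sub[of e] assms(3,5) xy by auto
  obtain vs es where w: "walk (X\<lparr>edges := F'\<rparr>) vs es" "hd vs = y" "last vs = x" "distinct vs"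
    by (rule simple_walk_exists[OF cut_connected_root[OF assms(1) F' assms(4), of y] F' xyV(2,1)])
  have c: "length vs = Suc (length es)" "set vs \<subseteq> verts X" "set es \<subseteq> F'"
      "\<forall>k < length es. ends X (es ! k) = {vs ! k, vs ! Suc k}"
    using w(1) unfolding walk_def by auto
  have ne: "vs \<noteq> []" using c(1) by auto
  have y: "vs ! 0 = y" using w(2) ne by (simp add: hd_conv_nth)
  \<comment> \<open>The vertex \<open>vs ! Suc j\<close> occurs only once on the walk, after both
    ends of the earlier edge \<open>es ! i\<close>.\<close>
  have "es ! i \<noteq> es ! j" if "i < j" "j < length es" for i j
  proof
    assume "es ! i = es ! j"
    then have "{vs ! i, vs ! Suc i} = {vs ! j, vs ! Suc j}" using c(4) that by (metis less_trans)
    then have "vs ! Suc j \<in> {vs ! i, vs ! Suc i}" by blast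
    then show False using w(4) c(1) that by (simp add: nth_eq_iff_index_eq)
  qed
  then have "distinct es" unfolding distinct_conv_nth by (metis nat_neq_iff)
  moreover have "ends X ((e # es) ! k) = {(x # vs) ! k, (x # vs) ! Suc k}"
    if "k < Suc (length es)" for k
    using that c(4) xy y by (cases k) simp_all
  moreover have "set es \<subseteq> F" "e \<notin> set es" using c(3) assms(2,6) by auto
  ultimately have "is_cycle (X\<lparr>edges := F\<rparr>) (x # vs) (e # es)"
    using c(1,2) w(3,4) ne xyV(1) assms(5) unfolding is_cycle_def walk_def by simp
  then show ?thesis by blast
qed

text \<open>A connected edge set contains a rooted forest, and any further edge would create a
  cycle. Conversely, an edge of a cycle could be removed while keeping all cuts crossed, leaving
  fewer edges than \<open>card_le_of_cut_connected\<close> allows.\<close>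

lemma is_tree_iff:
  assumes "F \<subseteq> edges X" "r \<in> verts X"
  shows "is_tree (X\<lparr>edges := F\<rparr>) \<longleftrightarrow> F \<in> rooted_forests X (edges X) {r}"
proof
  assume T: "is_tree (X\<lparr>edges := F\<rparr>)"
  then have cc: "cut_connected X {r} F"
    using connected_multigraph_iff[OF assms] unfolding is_tree_def by simp
  then obtain F' where F': "F' \<in> rooted_forests X F {r}"
    using rooted_forest_exists[OF cc assms(1)] assms(2) by blast
  have "F' = F"
  proof (rule ccontr)
    assume "F' \<noteq> F"
    then obtain e where "e \<in> F" "e \<notin> F'" using F' unfolding rooted_forests_def by blast
    then show False
      using cycle_exists[of r F' F e] F' assms T unfolding rooted_forests_def is_tree_def by blast
  qed
  then show "F \<in> rooted_forests X (edges X) {r}"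
    using F' assms(1) unfolding rooted_forests_def by simp
next
  assume R: "F \<in> rooted_forests X (edges X) {r}"
  then have cc: "cut_connected X {r} F" and card: "card F = card (verts X - {r})"
    unfolding rooted_forests_def by simp_all
  have False if cyc: "is_cycle (X\<lparr>edges := F\<rparr>) vs es" for vs es
  proof -
    note rem = cut_connected_removable[OF cc assms(1) cyc]
    have "card (verts X - {r}) \<le> card (F - {es ! 0})"
      using card_le_of_cut_connected[OF rem(2)] assms by blast
    also have "\<dots> < card F"
      using rem(1) finite_subset[OF assms(1) finite_edges] by (intro card_Diff1_less)
    finally show False using card by simp
  qed
  then show "is_tree (X\<lparr>edges := F\<rparr>)"
    using cc connected_multigraph_iff[OF assms] unfolding is_tree_def by blast
qed

lemma spanning_trees_eq:
  "r \<in> verts X \<Longrightarrow> spanning_trees X = rooted_forests X (edges X) {r}"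
  using is_tree_iff unfolding spanning_trees_def by (auto simp: rooted_forests_def)

end

section \<open>The matrix-tree theorem\<close>

text \<open>Additivity of the determinant in row \<open>k\<close>, stated by entries so that it
  applies directly to matrices given by formulas.\<close>

lemma det_add_row:
  fixes A B C :: "'a :: comm_ring_1 mat"
  assumes car: "A \<in> carrier_mat n n" "B \<in> carrier_mat n n" "C \<in> carrier_mat n n" and k: "k < n"
    and row: "\<And>j. j < n \<Longrightarrow> A $$ (k, j) = B $$ (k, j) + C $$ (k, j)"
    and eq: "\<And>i j. i < n \<Longrightarrow> j < n \<Longrightarrow> i \<noteq> k \<Longrightarrow> A $$ (i, j) = B $$ (i, j)"
      "\<And>i j. i < n \<Longrightarrow> j < n \<Longrightarrow> i \<noteq> k \<Longrightarrow> A $$ (i, j) = C $$ (i, j)"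
  shows "det A = det B + det C"
proof -
  have "A = mat\<^sub>r n n (\<lambda>i. if i = k then Matrix.row B i + Matrix.row C i else Matrix.row A i)"
    using car row k by (intro eq_matI) auto
  moreover have "B = mat\<^sub>r n n (\<lambda>i. if i = k then Matrix.row B i else Matrix.row A i)"
    using car eq(1) by (intro eq_matI) auto
  moreover have "C = mat\<^sub>r n n (\<lambda>i. if i = k then Matrix.row C i else Matrix.row A i)"
    using car eq(2) by (intro eq_matI) auto
  moreover have "Matrix.row B k \<in> carrier_vec n" "Matrix.row C k \<in> carrier_vec n"
      "Matrix.row A \<in> {0..<n} \<rightarrow> carrier_vec n"
    using car k by auto
  ultimately show ?thesis using det_row_add[of "Matrix.row B" k n "Matrix.row C" "Matrix.row A"] k by metis
qed

text \<open>The contribution of one edge to the Laplacian. The cardinality test makes loops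
  contribute zero.\<close>

definition edge_form :: "('v, 'e) multigraph \<Rightarrow> 'e \<Rightarrow> 'v \<Rightarrow> 'v \<Rightarrow> int" where
  "edge_form X e u v =
     (if card (ends X e) = 2 \<and> u \<in> ends X e \<and> v \<in> ends X e then if u = v then 1 else -1 else 0)"

text \<open>The contribution has rank one: it is the square of the difference of the two endpoint
  vectors. For a loop this difference is zero, so no case distinction remains.\<close>

lemma edge_form_pair:
  "ends X e = {x, y} \<Longrightarrow>
    edge_form X e u v = (of_bool (u = x) - of_bool (u = y)) * (of_bool (v = x) - of_bool (v = y))"
  unfolding edge_form_def by (cases "x = y") auto

definition laplacian :: "('v, 'e) multigraph \<Rightarrow> 'e set \<Rightarrow> 'v \<Rightarrow> 'v \<Rightarrow> int" where
  "laplacian X E u v = (\<Sum>e\<in>E. edge_form X e u v)"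

text \<open>Deleting the rows and columns indexed by \<open>R\<close> is replaced by turning the rows of \<open>R\<close> into
  unit vectors, which has the same determinant and keeps the dimension fixed.\<close>

definition rooted_laplacian ::
    "('v, 'e) multigraph \<Rightarrow> (nat \<Rightarrow> 'v) \<Rightarrow> 'e set \<Rightarrow> 'v set \<Rightarrow> int mat" where
  "rooted_laplacian X f E R = mat (card (verts X)) (card (verts X))
     (\<lambda>(a, b). if f a \<in> R then of_bool (a = b) else laplacian X E (f a) (f b))"

context finite_multigraph
begin

lemma rooted_forests_empty:
  assumes "E \<subseteq> edges X" "R \<subset> verts X"
    and "\<And>e r v. e \<in> E \<Longrightarrow> ends X e = {r, v} \<Longrightarrow> r \<in> R \<Longrightarrow> v \<in> R"
  shows "rooted_forests X E R = {}"
proof -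
  have False if "F \<subseteq> E" "cut_connected X R F" for F
  proof -
    have "F \<subseteq> edges X" using that(1) assms(1) by blast
    from crossing_edge[OF that(2) this assms(2)] obtain e r v where
      e: "e \<in> F" "ends X e = {r, v}" "r \<in> R" "v \<notin> R" .
    then show False using assms(3)[of e r v] that(1) by auto
  qed
  then show ?thesis unfolding rooted_forests_def by blast
qed

lemma rooted_forests_all:
  assumes "E \<subseteq> edges X"
  shows "rooted_forests X E (verts X) = {{}}"
proof -
  have "F = {}" if "F \<subseteq> E" "card F = 0" for F
    using that assms finite_edges by (metis card_0_eq finite_subset)
  then show ?thesis unfolding rooted_forests_def cut_connected_def by auto
qed

text \<open>Deletion and contraction: a forest either avoids \<open>e\<close>, or removing
  \<open>e\<close> from it leaves a forest rooted at \<open>insert v R\<close>.\<close>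

lemma card_rooted_forests_step:
  assumes "E \<subseteq> edges X" "R \<subseteq> verts X" "e \<in> E" "ends X e = {r, v}" "r \<in> R" "v \<notin> R"
  shows "card (rooted_forests X E R) =
    card (rooted_forests X (E - {e}) R) + card (rooted_forests X (E - {e}) (insert v R))"
proof -
  have fin: "finite E" using assms(1) finite_edges finite_subset by blast
  then have fr: "finite (rooted_forests X (E - {e}) S)" for S
    unfolding rooted_forests_def by simp
  have "v \<in> verts X" using ends_sub[of e] assms by auto
  then have c: "card (verts X - R) = Suc (card (verts X - insert v R))"
    using assms(6) finite_verts
    by (metis Diff_insert card_Suc_Diff1 finite_Diff Diff_iff)
  have ins: "insert e F \<in> rooted_forests X E R \<longleftrightarrow> F \<in> rooted_forests X (E - {e}) (insert v R)"
    if "e \<notin> F" for F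
  proof -
    have "insert e F \<subseteq> E \<longleftrightarrow> F \<subseteq> E - {e}" using that assms(3) by blast
    moreover have "finite F" if "F \<subseteq> E - {e}"
      using that fin finite_subset by blast
    ultimately show ?thesis
      using that c cut_connected_insert[OF assms(4-6), of F]
      unfolding rooted_forests_def by auto
  qed
  have "rooted_forests X E R =
    rooted_forests X (E - {e}) R \<union> insert e ` rooted_forests X (E - {e}) (insert v R)" (is "?L = ?A \<union> ?B")
  proof (intro equalityI subsetI)
    fix F assume F: "F \<in> ?L"
    show "F \<in> ?A \<union> ?B"
    proof (cases "e \<in> F")
      case True
      then have i: "insert e (F - {e}) = F" by blast
      then have "F - {e} \<in> rooted_forests X (E - {e}) (insert v R)" using ins[of "F - {e}"] F by simp
      then show ?thesis using i by (metis UnI2 imageI)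
    next
      case False
      then show ?thesis using F unfolding rooted_forests_def by auto
    qed
  next
    fix F assume "F \<in> ?A \<union> ?B"
    then show "F \<in> ?L"
    proof
      assume "F \<in> ?A"
      then show ?thesis unfolding rooted_forests_def by auto
    next
      assume "F \<in> ?B"
      then obtain F' where F': "F = insert e F'" "F' \<in> rooted_forests X (E - {e}) (insert v R)" by blast
      then have "e \<notin> F'" unfolding rooted_forests_def by auto
      then show ?thesis using ins F' by simp
    qed
  qed
  moreover have "?A \<inter> ?B = {}" unfolding rooted_forests_def by auto
  moreover have "inj_on (insert e) (rooted_forests X (E - {e}) (insert v R))"
  proof (rule inj_onI)
    fix F F' assume "F \<in> rooted_forests X (E - {e}) (insert v R)"
      "F' \<in> rooted_forests X (E - {e}) (insert v R)" and i: "insert e F = insert e F'"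
    then have "e \<notin> F" "e \<notin> F'" unfolding rooted_forests_def by auto
    then show "F = F'" using i by (metis Diff_insert_absorb)
  qed
  ultimately show ?thesis using fr by (simp add: card_Un_disjoint card_image)
qed

lemma laplacian_remove:
  assumes "E \<subseteq> edges X" "e \<in> E"
  shows "laplacian X E u v = edge_form X e u v + laplacian X (E - {e}) u v"
  using assms finite_subset[OF assms(1) finite_edges] unfolding laplacian_def by (simp add: sum.remove)

text \<open>The determinant obeys the same deletion-contraction rule. The edge \<open>e\<close> adds
  to the row of \<open>v\<close> the unit vector at \<open>v\<close> minus the unit vector at
  \<open>r\<close>; splitting this row off gives the two summands.\<close>

lemma det_rooted_laplacian_step:
  assumes f: "bij_betw f {..<card (verts X)} (verts X)"
    and E: "E \<subseteq> edges X" "e \<in> E" "ends X e = {r, v}" "r \<in> R" "v \<notin> R"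
  shows "det (rooted_laplacian X f E R) =
    det (rooted_laplacian X f (E - {e}) R) + det (rooted_laplacian X f (E - {e}) (insert v R))"
proof -
  let ?n = "card (verts X)"
  have rv: "r \<in> verts X" "v \<in> verts X" "r \<noteq> v" using ends_sub[of e] E by auto
  obtain k l where k: "k < ?n" "f k = v" and l: "l < ?n" "f l = r"
    using f rv unfolding bij_betw_def by (metis imageE lessThan_iff)
  have kl: "k \<noteq> l" using k l rv by auto
  have inj: "f a = f b \<longleftrightarrow> a = b" if "a < ?n" "b < ?n" for a b
    using f that unfolding bij_betw_def inj_on_def by auto
  note rem = laplacian_remove[OF E(1,2)] edge_form_pair[OF E(3)]
  \<comment> \<open>In the matrix for \<open>insert v R\<close> the rows of \<open>v\<close> and
    \<open>r\<close> are unit vectors, so subtracting row \<open>l\<close> from row \<open>k\<close>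
    produces exactly the contribution of \<open>e\<close> to the row of \<open>v\<close>.\<close>
  have "det (rooted_laplacian X f E R) = det (rooted_laplacian X f (E - {e}) R)
      + det (addrow (-1) k l (rooted_laplacian X f (E - {e}) (insert v R)))"
  proof (rule det_add_row[where k = k and n = ?n])
    fix j assume j: "j < ?n"
    have "rooted_laplacian X f E R $$ (k, j) =
        laplacian X (E - {e}) v (f j) + of_bool (f j = v) - of_bool (f j = r)"
      using j k E(5) rv(3) by (simp add: rooted_laplacian_def rem)
    moreover have "rooted_laplacian X f (E - {e}) R $$ (k, j) = laplacian X (E - {e}) v (f j)"
      using j k E(5) by (simp add: rooted_laplacian_def)
    moreover have "addrow (-1) k l (rooted_laplacian X f (E - {e}) (insert v R)) $$ (k, j) =
        of_bool (k = j) - of_bool (l = j)"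
      using j k l E(4) by (simp add: rooted_laplacian_def)
    moreover have "k = j \<longleftrightarrow> f j = v" "l = j \<longleftrightarrow> f j = r"
      using inj[OF k(1) j] inj[OF l(1) j] k(2) l(2) by auto
    ultimately show "rooted_laplacian X f E R $$ (k, j) = rooted_laplacian X f (E - {e}) R $$ (k, j) +
        addrow (-1) k l (rooted_laplacian X f (E - {e}) (insert v R)) $$ (k, j)"
      by simp
  next
    fix i j assume i: "i < ?n" "j < ?n" "i \<noteq> k"
    then have v: "f i \<noteq> v" using inj[of i k] k by auto
    \<comment> \<open>Apart from the row of \<open>v\<close>, only the row of \<open>r\<close> could
      feel \<open>e\<close>, and it is a unit vector because \<open>r\<close> lies in
      \<open>R\<close>.\<close>
    have "rooted_laplacian X f E R $$ (i, j) = rooted_laplacian X f (E - {e}) R $$ (i, j)"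
    proof (cases "f i \<in> R")
      case True
      then show ?thesis using i by (simp add: rooted_laplacian_def)
    next
      case False
      then have "f i \<noteq> r" using E(4) by auto
      then show ?thesis using i v False by (simp add: rooted_laplacian_def rem)
    qed
    moreover have "addrow (-1) k l (rooted_laplacian X f (E - {e}) (insert v R)) $$ (i, j) =
        rooted_laplacian X f (E - {e}) R $$ (i, j)"
      using i v k(1) by (simp add: rooted_laplacian_def)
    ultimately show "rooted_laplacian X f E R $$ (i, j) = rooted_laplacian X f (E - {e}) R $$ (i, j)"
      "rooted_laplacian X f E R $$ (i, j) =
        addrow (-1) k l (rooted_laplacian X f (E - {e}) (insert v R)) $$ (i, j)"
      by simp_all
  qed (use k in \<open>auto simp: rooted_laplacian_def\<close>)
  also have "det (addrow (-1) k l (rooted_laplacian X f (E - {e}) (insert v R))) =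
      det (rooted_laplacian X f (E - {e}) (insert v R))"
    by (rule det_addrow[OF l(1) kl]) (simp add: rooted_laplacian_def)
  finally show ?thesis .
qed

text \<open>If no edge leaves \<open>R\<close>, the indicator function of the complement of \<open>R\<close> lies in the kernel.\<close>

lemma det_rooted_laplacian_eq_0:
  assumes f: "bij_betw f {..<card (verts X)} (verts X)"
    and E: "E \<subseteq> edges X" and R: "R \<subset> verts X"
    and closed: "\<And>e r v. e \<in> E \<Longrightarrow> ends X e = {r, v} \<Longrightarrow> r \<in> R \<Longrightarrow> v \<in> R"
  shows "det (rooted_laplacian X f E R) = 0"
proof -
  let ?n = "card (verts X)"
  define w :: "int vec" where "w = vec ?n (\<lambda>a. of_bool (f a \<notin> R))"
  from R obtain v where "v \<in> verts X" "v \<notin> R" by blast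
  then obtain k where k: "k < ?n" "f k \<notin> R"
    using f unfolding bij_betw_def by (metis imageE lessThan_iff)
  have "w \<noteq> 0\<^sub>v ?n"
  proof
    assume "w = 0\<^sub>v ?n"
    then have "w $ k = 0" using k by simp
    then show False using k unfolding w_def by simp
  qed
  moreover have "rooted_laplacian X f E R *\<^sub>v w = 0\<^sub>v ?n"
  proof (rule eq_vecI)
    fix a assume "a < dim_vec (0\<^sub>v ?n :: int vec)"
    then have a: "a < ?n" by simp
    \<comment> \<open>Both ends of \<open>e\<close> lie on the same side of \<open>R\<close>, so
      their contributions cancel or are both absent.\<close>
    have form: "(\<Sum>v\<in>verts X. edge_form X e u v * of_bool (v \<notin> R)) = 0" if "e \<in> E" for e u
    proof -
      obtain x y where xy: "ends X e = {x, y}" using ends_pair \<open>e \<in> E\<close> E by blast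
      have V: "x \<in> verts X" "y \<in> verts X" using ends_sub[of e] \<open>e \<in> E\<close> E xy by auto
      have "x \<in> R \<longleftrightarrow> y \<in> R"
        using closed[OF \<open>e \<in> E\<close>, of x y] closed[OF \<open>e \<in> E\<close>, of y x] xy by (auto simp: insert_commute)
      then have "(\<Sum>v\<in>verts X. edge_form X e u v * of_bool (v \<notin> R)) =
          (of_bool (u = x) - of_bool (u = y)) * of_bool (x \<notin> R) *
          ((\<Sum>v\<in>verts X. of_bool (v = x)) - (\<Sum>v\<in>verts X. of_bool (v = y)))"
        unfolding edge_form_pair[OF xy] sum_subtractf[symmetric] sum_distrib_left
        by (intro sum.cong refl) auto
      then show ?thesis using V finite_verts by (simp add: of_bool_def sum.delta)
    qed
    have "(rooted_laplacian X f E R *\<^sub>v w) $ a =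
        (\<Sum>b\<in>{..<?n}. (if f a \<in> R then of_bool (a = b) else laplacian X E (f a) (f b)) * of_bool (f b \<notin> R))"
      using a unfolding rooted_laplacian_def w_def
      by (simp add: scalar_prod_def atLeast0LessThan)
    also have "\<dots> = 0"
    proof (cases "f a \<in> R")
      case True
      then show ?thesis by (auto intro!: sum.neutral)
    next
      case False
      then have "(\<Sum>b\<in>{..<?n}. (if f a \<in> R then of_bool (a = b) else laplacian X E (f a) (f b)) * of_bool (f b \<notin> R))
        = (\<Sum>b\<in>{..<?n}. laplacian X E (f a) (f b) * of_bool (f b \<notin> R))" by simp
      also have "\<dots> = (\<Sum>v\<in>verts X. laplacian X E (f a) v * of_bool (v \<notin> R))"
        by (rule sum.reindex_bij_betw[OF f])
      also have "\<dots> = (\<Sum>e\<in>E. \<Sum>v\<in>verts X. edge_form X e (f a) v * of_bool (v \<notin> R))"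
        unfolding laplacian_def sum_distrib_right by (rule sum.swap)
      also have "\<dots> = 0" using form by simp
      finally show ?thesis .
    qed
    finally show "(rooted_laplacian X f E R *\<^sub>v w) $ a = 0\<^sub>v ?n $ a" using a by simp
  qed (simp add: rooted_laplacian_def)
  moreover have "w \<in> carrier_vec ?n" unfolding w_def by simp
  moreover have "rooted_laplacian X f E R \<in> carrier_mat ?n ?n" unfolding rooted_laplacian_def by simp
  ultimately show ?thesis using det_0_iff_vec_prod_zero by blast
qed

text \<open>Both sides satisfy the deletion-contraction rule, so induction on the number of edges
  reduces to the cases without an edge leaving \<open>R\<close>. There both sides are 1 if
  \<open>R\<close> contains all vertices, and 0 otherwise.\<close>

theorem card_rooted_forests:
  assumes f: "bij_betw f {..<card (verts X)} (verts X)"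
    and "E \<subseteq> edges X" "R \<subseteq> verts X"
  shows "int (card (rooted_forests X E R)) = det (rooted_laplacian X f E R)"
  using assms(2,3)
proof (induction "card E" arbitrary: E R rule: less_induct)
  case less
  consider "R = verts X"
    | e r v where "e \<in> E" "ends X e = {r, v}" "r \<in> R" "v \<notin> R"
    | "R \<subset> verts X" "\<And>e r v. e \<in> E \<Longrightarrow> ends X e = {r, v} \<Longrightarrow> r \<in> R \<Longrightarrow> v \<in> R"
    using less.prems(2) by blast
  then show ?case
  proof cases
    case 1
    have "f a \<in> verts X" if "a < card (verts X)" for a using f that unfolding bij_betw_def by auto
    then have "rooted_laplacian X f E R = 1\<^sub>m (card (verts X))"
      unfolding rooted_laplacian_def 1 by (intro eq_matI) auto
    then show ?thesis using rooted_forests_all[OF less.prems(1)] 1 by simp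
  next
    case 2
    have "card (E - {e}) < card E"
      using 2(1) finite_subset[OF less.prems(1) finite_edges] by (intro card_Diff1_less)
    moreover have "v \<in> verts X" using ends_sub[of e] 2 less.prems by auto
    ultimately show ?thesis
      using less.hyps[of "E - {e}" R] less.hyps[of "E - {e}" "insert v R"] less.prems
        card_rooted_forests_step[OF less.prems 2] det_rooted_laplacian_step[OF f less.prems(1) 2]
      by (simp add: subset_insertI2 Diff_subset[THEN subset_trans])
  next
    case 3
    then show ?thesis
      using rooted_forests_empty[OF less.prems(1)] det_rooted_laplacian_eq_0[OF f less.prems(1)] by simp
  qed
qed

end

section \<open>Determinants of circulant matrices\<close>

definition root_of_unity :: "nat \<Rightarrow> nat \<Rightarrow> complex" where
  "root_of_unity N j = cis (2 * pi * real j / real N)"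

text \<open>Its columns are the common eigenvectors of all circulant matrices of size
  \<open>N\<close>.\<close>

definition fourier_mat :: "nat \<Rightarrow> complex mat" where
  "fourier_mat N = mat N N (\<lambda>(u, j). root_of_unity N j ^ u)"

lemma root_of_unity_bij: "0 < N \<Longrightarrow> bij_betw (root_of_unity N) {..<N} {z. z ^ N = 1}"
  using bij_betw_roots_unity unfolding root_of_unity_def .

lemma root_of_unity_power: "j < N \<Longrightarrow> root_of_unity N j ^ N = 1"
  using bij_betwE[OF root_of_unity_bij] by auto

lemma root_of_unity_0 [simp]: "root_of_unity N 0 = 1"
  unfolding root_of_unity_def by simp

lemma root_of_unity_eq_1_iff: "j < N \<Longrightarrow> root_of_unity N j = 1 \<longleftrightarrow> j = 0"
  using bij_betw_imp_inj_on[OF root_of_unity_bij, of N] root_of_unity_0[of N]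
  by (metis bot_nat_0.not_eq_extremum inj_on_eq_iff lessThan_iff not_less_zero)

lemma sum_powers_root:
  assumes "(z :: complex) ^ N = 1" "z \<noteq> 1"
  shows "(\<Sum>u<N. z ^ u) = 0"
  using assms by (simp add: geometric_sum)

lemma mat_diag_det: "det (mat n n (\<lambda>(i, j). if i = j then d i else 0)) = (\<Prod>i<n. d i :: 'a :: comm_ring_1)"
proof -
  have "det (mat n n (\<lambda>(i, j). if i = j then d i else 0)) =
      prod_list (diag_mat (mat n n (\<lambda>(i, j). if i = j then d i else 0)))"
    by (rule det_upper_triangular[of _ n]) (auto intro!: upper_triangularI)
  then show ?thesis
    by (simp add: prod_list_diag_prod atLeast0LessThan)
qed

text \<open>The sum of all rows is \<open>(N, 0, ..., 0)\<close>, because the powers of a nontrivial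
  root sum to zero; expanding along it gives the first claim. The minor obtained here is the one
  that appears for reduced circulants.\<close>

lemma det_fourier_mat:
  assumes "0 < N"
  shows "det (fourier_mat N) = of_nat N * det (mat_delete (fourier_mat N) 0 0)"
    and "det (fourier_mat N) \<noteq> 0"
proof -
  let ?V = "fourier_mat N"
  have V: "?V \<in> carrier_mat N N" unfolding fourier_mat_def by simp
  \<comment> \<open>Multiplication by \<open>L\<close> adds all other rows to row 0; it is
    triangular with ones on the diagonal.\<close>
  define L :: "complex mat" where "L = mat N N (\<lambda>(i, j). if i = 0 \<or> i = j then 1 else 0)"
  have L: "L \<in> carrier_mat N N" unfolding L_def by simp
  have "det L = prod_list (diag_mat L)"
    by (rule det_upper_triangular[OF _ L]) (auto simp: L_def intro!: upper_triangularI)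
  then have dL: "det L = 1" by (simp add: prod_list_diag_prod L_def)
  have row0: "(L * ?V) $$ (0, j) = (if j = 0 then of_nat N else 0)" if "j < N" for j
  proof -
    have "(L * ?V) $$ (0, j) = (\<Sum>u<N. root_of_unity N j ^ u)"
      using that assms unfolding L_def fourier_mat_def by (simp add: scalar_prod_def atLeast0LessThan)
    then show ?thesis
      using that sum_powers_root[OF root_of_unity_power[OF that]] root_of_unity_eq_1_iff[OF that] by auto
  qed
  have "(L * ?V) $$ (u, j) = ?V $$ (u, j)" if "u < N" "j < N" "u \<noteq> 0" for u j
  proof -
    have "(L * ?V) $$ (u, j) = (\<Sum>k<N. (if u = k then 1 else 0) * ?V $$ (k, j))"
      using that unfolding L_def fourier_mat_def by (simp add: scalar_prod_def atLeast0LessThan)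
    also have "\<dots> = (\<Sum>k<N. if u = k then ?V $$ (k, j) else 0)" by (intro sum.cong) auto
    finally show ?thesis using that by simp
  qed
  then have del: "mat_delete (L * ?V) 0 0 = mat_delete ?V 0 0"
    using L V unfolding mat_delete_def by (intro eq_matI) auto
  have "det ?V = det (L * ?V)" using det_mult[OF L V] dL by simp
  also have "\<dots> = (\<Sum>j<N. (L * ?V) $$ (0, j) * cofactor (L * ?V) 0 j)"
    using L V assms by (intro laplace_expansion_row) auto
  also have "\<dots> = (\<Sum>j<N. if j = 0 then of_nat N * cofactor (L * ?V) 0 j else 0)"
    using row0 by (intro sum.cong) auto
  also have "\<dots> = of_nat N * cofactor (L * ?V) 0 0" using assms by simp
  finally show "det ?V = of_nat N * det (mat_delete ?V 0 0)" unfolding cofactor_def del by simp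

  \<comment> \<open>The conjugate transpose of the Fourier matrix; orthogonality of characters makes
    the product \<open>N\<close> times the identity.\<close>
  define W :: "complex mat" where "W = mat N N (\<lambda>(i, u). inverse (root_of_unity N i) ^ u)"
  have W: "W \<in> carrier_mat N N" unfolding W_def by simp
  have "W * ?V = mat N N (\<lambda>(i, j). if i = j then of_nat N else 0)"
  proof (rule eq_matI)
    fix i j assume "i < dim_row (mat N N (\<lambda>(i, j). if i = j then of_nat N else (0 :: complex)))"
      "j < dim_col (mat N N (\<lambda>(i, j). if i = j then of_nat N else (0 :: complex)))"
    then have ij: "i < N" "j < N" by auto
    have nz: "root_of_unity N i \<noteq> 0" unfolding root_of_unity_def by simp
    define r where "r = inverse (root_of_unity N i) * root_of_unity N j"
    have "r ^ N = 1" using ij root_of_unity_power unfolding r_def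
      by (simp add: power_mult_distrib power_inverse)
    moreover have "r = 1 \<longleftrightarrow> i = j"
    proof -
      have "r = 1 \<longleftrightarrow> root_of_unity N i = root_of_unity N j" unfolding r_def using nz by (auto simp: field_simps)
      also have "\<dots> \<longleftrightarrow> i = j"
        using bij_betw_imp_inj_on[OF root_of_unity_bij[OF assms]] ij by (simp add: inj_on_eq_iff)
      finally show ?thesis .
    qed
    moreover have "(W * ?V) $$ (i, j) = (\<Sum>u<N. r ^ u)"
      using ij unfolding W_def fourier_mat_def r_def
      by (simp add: scalar_prod_def atLeast0LessThan power_mult_distrib)
    ultimately show "(W * ?V) $$ (i, j) = mat N N (\<lambda>(i, j). if i = j then of_nat N else 0) $$ (i, j)"
      using ij sum_powers_root[of r N] by (cases "i = j") auto
  qed (auto simp: W_def fourier_mat_def)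
  then have "det W * det ?V = (\<Prod>i<N. of_nat N)"
    using det_mult[OF W V] mat_diag_det[of N "\<lambda>_. of_nat N :: complex"] by simp
  then show "det ?V \<noteq> 0" using assms by auto
qed

text \<open>The eigenvalue hypothesis says \<open>A V = V D\<close> with \<open>V\<close> the
  Fourier matrix and \<open>D\<close> diagonal, and \<open>det V\<close> cancels.\<close>

lemma det_circulant:
  fixes A :: "complex mat"
  assumes "0 < N" and A: "A \<in> carrier_mat N N"
    and ev: "\<And>u z. u < N \<Longrightarrow> z ^ N = 1 \<Longrightarrow> (\<Sum>v<N. A $$ (u, v) * z ^ v) = h z * z ^ u"
  shows "det A = (\<Prod>z | z ^ N = 1. h z)"
proof -
  let ?V = "fourier_mat N"
  define D where "D = mat N N (\<lambda>(i, j). if i = j then h (root_of_unity N i) else 0)"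
  have car: "?V \<in> carrier_mat N N" "D \<in> carrier_mat N N" unfolding fourier_mat_def D_def by simp_all
  have "A * ?V = ?V * D"
  proof (rule eq_matI)
    fix u j assume "u < dim_row (?V * D)" "j < dim_col (?V * D)"
    then have uj: "u < N" "j < N" using car by auto
    have "(?V * D) $$ (u, j) = (\<Sum>k<N. root_of_unity N k ^ u * (if k = j then h (root_of_unity N k) else 0))"
      using uj unfolding fourier_mat_def D_def by (simp add: scalar_prod_def atLeast0LessThan)
    also have "\<dots> = (\<Sum>k<N. if k = j then root_of_unity N k ^ u * h (root_of_unity N k) else 0)"
      by (intro sum.cong) auto
    also have "\<dots> = h (root_of_unity N j) * root_of_unity N j ^ u" using uj by simp
    finally show "(A * ?V) $$ (u, j) = (?V * D) $$ (u, j)"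
      using uj A ev[OF uj(1) root_of_unity_power[OF uj(2)]] unfolding fourier_mat_def
      by (simp add: scalar_prod_def atLeast0LessThan)
  qed (use A car in auto)
  then have "det A * det ?V = det D * det ?V"
    using det_mult[OF A car(1)] det_mult[OF car] by (metis mult.commute)
  then have "det A = det D" using det_fourier_mat(2)[OF assms(1)] mult_right_cancel by blast
  also have "\<dots> = (\<Prod>j<N. h (root_of_unity N j))" unfolding D_def by (rule mat_diag_det)
  also have "\<dots> = (\<Prod>z | z ^ N = 1. h z)" by (rule prod.reindex_bij_betw[OF root_of_unity_bij[OF assms(1)]])
  finally show ?thesis .
qed

text \<open>With row 0 replaced by a unit vector and \<open>h 1 = 0\<close>, column 0 of
  \<open>A V\<close> is the first unit vector, and the complementary block is \<open>W D\<close>,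
  where \<open>W\<close> is the minor of \<open>V\<close> and \<open>D\<close> carries the
  nontrivial eigenvalues. Since \<open>det V = N det W\<close>, cancelling \<open>det W\<close>
  leaves the factor \<open>N\<close>.\<close>

lemma det_reduced_circulant:
  fixes A :: "complex mat"
  assumes "0 < N" and A: "A \<in> carrier_mat N N"
    and row0: "\<And>v. v < N \<Longrightarrow> A $$ (0, v) = of_bool (v = 0)"
    and ev: "\<And>u z. 0 < u \<Longrightarrow> u < N \<Longrightarrow> z ^ N = 1 \<Longrightarrow> (\<Sum>v<N. A $$ (u, v) * z ^ v) = h z * z ^ u"
    and h1: "h 1 = 0"
  shows "of_nat N * det A = (\<Prod>z | z ^ N = 1 \<and> z \<noteq> 1. h z)"
proof -
  let ?V = "fourier_mat N"
  let ?W = "mat_delete ?V 0 0"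
  define D where "D = mat (N - 1) (N - 1) (\<lambda>(i, j). if i = j then h (root_of_unity N (Suc i)) else 0)"
  have V: "?V \<in> carrier_mat N N" unfolding fourier_mat_def by simp
  have car: "?W \<in> carrier_mat (N - 1) (N - 1)" "D \<in> carrier_mat (N - 1) (N - 1)"
    unfolding D_def using mat_delete_carrier[OF V] by simp_all
  have AV: "A * ?V \<in> carrier_mat N N" using A V by simp
  have X: "(A * ?V) $$ (u, j) = h (root_of_unity N j) * root_of_unity N j ^ u"
    if "0 < u" "u < N" "j < N" for u j
    using that A ev[OF that(1,2) root_of_unity_power[OF that(3)]] unfolding fourier_mat_def
    by (simp add: scalar_prod_def atLeast0LessThan)
  have X00: "(A * ?V) $$ (0, 0) = 1"
    using assms(1) A row0 unfolding fourier_mat_def by (simp add: scalar_prod_def atLeast0LessThan)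
  have del: "mat_delete (A * ?V) 0 0 = ?W * D"
  proof (rule eq_matI)
    fix u j assume "u < dim_row (?W * D)" "j < dim_col (?W * D)"
    then have uj: "u < N - 1" "j < N - 1" using car by auto
    have "(?W * D) $$ (u, j) =
        (\<Sum>k<N - 1. root_of_unity N (Suc k) ^ Suc u * (if k = j then h (root_of_unity N (Suc k)) else 0))"
      using uj V unfolding mat_delete_def D_def
      by (simp add: scalar_prod_def atLeast0LessThan fourier_mat_def)
    also have "\<dots> = (\<Sum>k<N - 1. if k = j then root_of_unity N (Suc k) ^ Suc u * h (root_of_unity N (Suc k)) else 0)"
      by (intro sum.cong) auto
    also have "\<dots> = h (root_of_unity N (Suc j)) * root_of_unity N (Suc j) ^ Suc u" using uj by simp
    also have "\<dots> = mat_delete (A * ?V) 0 0 $$ (u, j)"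
      using uj A V X[of "Suc u" "Suc j"] unfolding mat_delete_def by simp
    finally show "mat_delete (A * ?V) 0 0 $$ (u, j) = (?W * D) $$ (u, j)" by simp
  qed (use A V AV car in auto)
  have "det A * det ?V = det (A * ?V)" using det_mult[OF A V] by simp
  also have "\<dots> = (\<Sum>i<N. (A * ?V) $$ (i, 0) * cofactor (A * ?V) i 0)"
    using AV assms(1) by (intro laplace_expansion_column) auto
  also have "\<dots> = (\<Sum>i<N. if i = 0 then cofactor (A * ?V) i 0 else 0)"
    using X X00 h1 assms(1) by (intro sum.cong) auto
  also have "\<dots> = det ?W * det D"
    using assms(1) det_mult[OF car] del by (simp add: cofactor_def)
  finally have "of_nat N * det A * det ?W = det D * det ?W"
    using det_fourier_mat(1)[OF assms(1)] by (simp add: mult_ac)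
  moreover have "det ?W \<noteq> 0" using det_fourier_mat[OF assms(1)] by auto
  ultimately have "of_nat N * det A = det D" by simp
  also have "\<dots> = (\<Prod>j<N - 1. h (root_of_unity N (Suc j)))" unfolding D_def by (rule mat_diag_det)
  also have "\<dots> = (\<Prod>j\<in>{..<N} - {0}. h (root_of_unity N j))"
    by (rule prod.reindex_bij_witness[of _ "\<lambda>j. j - 1" Suc]) auto
  also have "\<dots> = (\<Prod>z\<in>{z. z ^ N = 1} - {1}. h z)"
    using bij_betw_DiffI[OF root_of_unity_bij[OF assms(1)], of "{0}" "{1}"] assms(1)
    by (intro prod.reindex_bij_betw) (simp add: bij_betw_def)
  also have "{z::complex. z ^ N = 1} - {1} = {z. z ^ N = 1 \<and> z \<noteq> 1}" by auto
  finally show ?thesis .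
qed

section \<open>Cyclic norms of integer polynomials\<close>

definition ceval :: "int poly \<Rightarrow> complex \<Rightarrow> complex" where
  "ceval F z = poly (map_poly of_int F) z"

lemma ceval_simps [simp]:
  "ceval 0 z = 0" "ceval 1 z = 1" "ceval [:c:] z = of_int c" "ceval (pCons a F) z = of_int a + z * ceval F z"
  "ceval (F + G) z = ceval F z + ceval G z" "ceval (F - G) z = ceval F z - ceval G z"
  "ceval (- F) z = - ceval F z" "ceval (F * G) z = ceval F z * ceval G z"
  "ceval (F ^ n) z = ceval F z ^ n" "ceval (Polynomial.smult c F) z = of_int c * ceval F z"
  "ceval (monom c n) z = of_int c * z ^ n"
  unfolding ceval_def by (simp_all add: hom_distribs poly_monom)

lemma ceval_sum [simp]: "ceval (\<Sum>i\<in>A. F i) z = (\<Sum>i\<in>A. ceval (F i) z)"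
  by (induction A rule: infinite_finite_induct) simp_all

lemma ceval_altdef: "ceval F z = (\<Sum>k\<le>degree F. of_int (coeff F k) * z ^ k)"
  unfolding ceval_def by (simp add: poly_altdef)

text \<open>The matrix of multiplication by \<open>F\<close> on the integer polynomials modulo
  \<open>x^N - 1\<close>; exponents are folded modulo \<open>N\<close>, so any degree is
  allowed.\<close>

definition circulant :: "nat \<Rightarrow> int poly \<Rightarrow> int mat" where
  "circulant N F = mat N N (\<lambda>(u, v). \<Sum>k\<le>degree F. if v = (u + k) mod N then coeff F k else 0)"

text \<open>The norm of \<open>F\<close> modulo \<open>x^N - 1\<close>. Defining it as a determinant
  makes it an integer by construction and gives access to congruences between matrix
  entries.\<close>

definition cyclic_norm :: "nat \<Rightarrow> int poly \<Rightarrow> int" where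
  "cyclic_norm N F = det (circulant N F)"

lemma power_mod_root: "(z :: complex) ^ N = 1 \<Longrightarrow> z ^ (k mod N) = z ^ k"
  by (metis div_mult_mod_eq mult_1 power_add power_mult power_one mult.commute)

lemma of_int_cyclic_norm:
  assumes "0 < N"
  shows "of_int (cyclic_norm N F) = (\<Prod>z | z ^ N = 1. ceval F z)"
proof -
  let ?A = "map_mat complex_of_int (circulant N F)"
  have "of_int (cyclic_norm N F) = det ?A" unfolding cyclic_norm_def by simp
  also have "\<dots> = (\<Prod>z | z ^ N = 1. ceval F z)"
  proof (rule det_circulant[OF assms])
    fix u z assume u: "u < N" and z: "(z :: complex) ^ N = 1"
    have "(\<Sum>v<N. ?A $$ (u, v) * z ^ v) =
        (\<Sum>v<N. \<Sum>k\<le>degree F. if v = (u + k) mod N then of_int (coeff F k) * z ^ v else 0)"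
    proof (rule sum.cong[OF refl])
      fix v assume "v \<in> {..<N}"
      then have "?A $$ (u, v) * z ^ v = (\<Sum>k\<le>degree F. of_int (if v = (u + k) mod N then coeff F k else 0) * z ^ v)"
        using u by (simp add: circulant_def sum_distrib_right)
      also have "\<dots> = (\<Sum>k\<le>degree F. if v = (u + k) mod N then of_int (coeff F k) * z ^ v else 0)"
        by (intro sum.cong) simp_all
      finally show "?A $$ (u, v) * z ^ v =
          (\<Sum>k\<le>degree F. if v = (u + k) mod N then of_int (coeff F k) * z ^ v else 0)" .
    qed
    also have "\<dots> = (\<Sum>k\<le>degree F. \<Sum>v<N. if v = (u + k) mod N then of_int (coeff F k) * z ^ v else 0)"
      by (rule sum.swap)
    also have "\<dots> = (\<Sum>k\<le>degree F. of_int (coeff F k) * z ^ (u + k))"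
      using assms by (intro sum.cong refl) (simp add: power_mod_root[OF z])
    finally show "(\<Sum>v<N. ?A $$ (u, v) * z ^ v) = ceval F z * z ^ u"
      by (simp add: ceval_altdef power_add sum_distrib_left mult_ac)
  qed (simp add: circulant_def)
  finally show ?thesis .
qed

section \<open>Congruences for cyclic norms modulo a prime\<close>

lemma det_cong:
  fixes A B :: "int mat"
  assumes "A \<in> carrier_mat n n" "B \<in> carrier_mat n n"
    and "\<And>i j. i < n \<Longrightarrow> j < n \<Longrightarrow> [A $$ (i, j) = B $$ (i, j)] (mod m)"
  shows "[det A = det B] (mod m)"
  unfolding det_def'[OF assms(1)] det_def'[OF assms(2)]
proof (intro cong_sum cong_mult cong_refl cong_prod)
  fix p i assume "p \<in> {p. p permutes {0..<n}}" "i \<in> {0..<n}"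
  then have "p i < n" using permutes_in_image[of p "{0..<n}" i] by auto
  then show "[A $$ (i, p i) = B $$ (i, p i)] (mod m)" using assms(3) \<open>i \<in> {0..<n}\<close> by auto
qed

lemma cyclic_norm_cong_const: "[cyclic_norm N ([:c:] + Polynomial.smult m H) = c ^ N] (mod m)"
proof -
  let ?F = "[:c:] + Polynomial.smult m H"
  have "[cyclic_norm N ?F = det (c \<cdot>\<^sub>m 1\<^sub>m N)] (mod m)"
    unfolding cyclic_norm_def
  proof (rule det_cong)
    fix i j assume ij: "i < N" "j < N"
    have "[(\<Sum>k\<le>degree ?F. if j = (i + k) mod N then coeff ?F k else 0) =
        (\<Sum>k\<le>degree ?F. if j = (i + k) mod N then coeff [:c:] k else 0)] (mod m)"
      by (intro cong_sum) (simp add: cong_def)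
    also have "(\<Sum>k\<le>degree ?F. if j = (i + k) mod N then coeff [:c:] k else 0) =
        (\<Sum>k\<le>degree ?F. if k = 0 then of_bool (i = j) * c else 0)"
      using ij by (intro sum.cong) (auto simp: coeff_pCons split: nat.splits)
    also have "\<dots> = (c \<cdot>\<^sub>m 1\<^sub>m N) $$ (i, j)" using ij by simp
    finally show "[circulant N ?F $$ (i, j) = (c \<cdot>\<^sub>m 1\<^sub>m N) $$ (i, j)] (mod m)"
      using ij unfolding circulant_def by simp
  qed (simp_all add: circulant_def)
  then show ?thesis by simp
qed

text \<open>Frobenius is additive modulo \<open>p\<close>. In the induction the congruence at level
  \<open>n\<close> is raised to the power \<open>p\<close>, using that \<open>a - b\<close> divides
  \<open>a^p - b^p\<close>, and combined with the binomial theorem.\<close>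

lemma prime_dvd_freshman:
  fixes x y :: "'a :: comm_ring_1"
  assumes "prime p"
  shows "of_nat p dvd (x + y) ^ (p ^ n) - (x ^ (p ^ n) + y ^ (p ^ n))"
proof (induction n)
  case (Suc n)
  have binom: "of_nat p dvd (x + y) ^ p - (x ^ p + y ^ p)" for x y :: 'a
  proof -
    have p: "0 < p" using assms by (simp add: prime_gt_0_nat)
    have "(x + y) ^ p = (\<Sum>k\<le>p. of_nat (p choose k) * x ^ k * y ^ (p - k))" by (rule binomial_ring)
    also have "\<dots> = (\<Sum>k\<in>{0, p}. of_nat (p choose k) * x ^ k * y ^ (p - k))
        + (\<Sum>k\<in>{..p} - {0, p}. of_nat (p choose k) * x ^ k * y ^ (p - k))"
      by (subst add.commute, rule sum.subset_diff) auto
    finally have "(x + y) ^ p - (x ^ p + y ^ p) =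
        (\<Sum>k\<in>{..p} - {0, p}. of_nat (p choose k) * x ^ k * y ^ (p - k))"
      using p by simp
    moreover have "of_nat p dvd (of_nat (p choose k) :: 'a)" if "k \<in> {..p} - {0, p}" for k
    proof -
      have "p dvd p choose k" using that assms by (intro dvd_choose_prime) auto
      then show ?thesis by (metis dvdE dvd_triv_left of_nat_mult)
    qed
    ultimately show ?thesis by (simp only:) (intro dvd_sum dvd_mult2)
  qed
  let ?a = "(x + y) ^ (p ^ n)" and ?b = "x ^ (p ^ n) + y ^ (p ^ n)"
  have "?a - ?b dvd ?a ^ p - ?b ^ p" by (simp add: power_diff_sumr2)
  then have "of_nat p dvd ?a ^ p - ?b ^ p" using Suc dvd_trans by blast
  from dvd_add[OF this binom[of "x ^ (p ^ n)" "y ^ (p ^ n)"]]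
  show ?case by (simp add: algebra_simps flip: power_mult)
qed simp

text \<open>Applying the sum version to \<open>x - y\<close> and \<open>y\<close> avoids the sign of
  \<open>(-y)^(p^n)\<close>, so \<open>p = 2\<close> is no exception.\<close>

lemma prime_dvd_freshman_diff:
  fixes x y :: "'a :: comm_ring_1"
  assumes "prime p"
  shows "of_nat p dvd (x - y) ^ (p ^ n) - (x ^ (p ^ n) - y ^ (p ^ n))"
proof -
  have "of_nat p dvd - ((x - y + y) ^ (p ^ n) - ((x - y) ^ (p ^ n) + y ^ (p ^ n)))"
    using prime_dvd_freshman[OF assms] by (subst dvd_minus_iff)
  then show ?thesis by (simp add: algebra_simps)
qed

lemma int_poly_at_1:
  obtains W where "F = [:poly F 1 :: int:] + [:-1, 1:] * W"
proof -
  have "[:-1, 1:] dvd F - [:poly F 1:]" by (simp add: dvd_iff_poly_eq_0)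
  then show thesis using that unfolding dvd_def by (metis add.commute diff_add_cancel)
qed

text \<open>Write \<open>F = c + (x - 1) W\<close> with \<open>c = F(1)\<close> and
  \<open>N = l^n\<close>. Modulo \<open>l\<close>, \<open>F^N\<close> is
  \<open>c^N + (x^N - 1) W^N\<close>, and the last term vanishes at all \<open>N\<close>-th roots of
  unity. Hence the norm of \<open>F^N\<close> is congruent to a power of \<open>c\<close>.\<close>

lemma cyclic_norm_not_dvd:
  assumes "prime l" "\<not> int l dvd poly F 1"
  shows "\<not> int l dvd cyclic_norm (l ^ n) F"
proof -
  let ?N = "l ^ n"
  have N: "0 < ?N" using assms(1) by (simp add: prime_gt_0_nat)
  define c where "c = poly F 1"
  obtain W where W: "F = [:c:] + [:-1, 1:] * W" unfolding c_def by (rule int_poly_at_1)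
  have "of_nat l dvd F ^ ?N - ([:c:] ^ ?N + ([:-1, 1:] * W) ^ ?N)"
    unfolding W by (rule prime_dvd_freshman[OF assms(1)])
  then obtain H where H: "F ^ ?N - ([:c:] ^ ?N + ([:-1, 1:] * W) ^ ?N) = of_nat l * H" by blast
  have "of_nat l dvd (monom 1 1 - 1) ^ ?N - (monom 1 1 ^ ?N - (1 :: int poly) ^ ?N)"
    by (rule prime_dvd_freshman_diff[OF assms(1)])
  then obtain K :: "int poly" where K: "(monom 1 1 - 1) ^ ?N - (monom 1 1 ^ ?N - 1 ^ ?N) = of_nat l * K" by blast
  \<comment> \<open>\<open>G\<close> takes the values of \<open>F ^ N\<close> at all
    \<open>N\<close>-th roots of unity, hence has the same cyclic norm, and it is visibly constant
    modulo \<open>l\<close>.\<close>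
  define G where "G = [:c ^ ?N:] + Polynomial.smult (int l) (H + K * W ^ ?N)"
  have "ceval (F ^ ?N) z = ceval G z" if z: "z ^ ?N = 1" for z
  proof -
    have l: "ceval (of_nat l) z = of_nat l" by (simp add: of_nat_poly)
    have "(z - 1) ^ ?N = of_nat l * ceval K z"
      using arg_cong[OF K, of "\<lambda>F. ceval F z"] z l by simp
    moreover have "ceval F z ^ ?N - (of_int c ^ ?N + ((z - 1) * ceval W z) ^ ?N) = of_nat l * ceval H z"
      using arg_cong[OF H, of "\<lambda>F. ceval F z"] l by (simp add: left_diff_distrib)
    ultimately have "ceval F z ^ ?N = of_int c ^ ?N + of_nat l * (ceval H z + ceval K z * ceval W z ^ ?N)"
      unfolding power_mult_distrib by (simp add: field_simps)
    then show ?thesis unfolding G_def by simp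
  qed
  then have "complex_of_int (cyclic_norm ?N F ^ ?N) = complex_of_int (cyclic_norm ?N G)"
    using of_int_cyclic_norm[OF N] by (simp add: prod_power_distrib)
  then have "cyclic_norm ?N F ^ ?N = cyclic_norm ?N G" by (simp only: of_int_eq_iff)
  then have "[cyclic_norm ?N F ^ ?N = (c ^ ?N) ^ ?N] (mod int l)"
    unfolding G_def using cyclic_norm_cong_const by simp
  then have "int l dvd cyclic_norm ?N F ^ ?N \<longleftrightarrow> int l dvd (c ^ ?N) ^ ?N"
    by (rule cong_dvd_iff)
  moreover have "prime (int l)" using assms(1) by simp
  then have "\<not> int l dvd (c ^ ?N) ^ ?N"
    using assms(2) prime_dvd_power unfolding c_def by blast
  ultimately show ?thesis using dvd_power[of ?N "cyclic_norm ?N F"] N dvd_trans by blast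
qed

section \<open>Spanning trees at a level of the tower\<close>

lemma P_unfold: "P a = [:0, 1:] * (of_nat (a\<^sup>2) - (\<Sum>k = 1..<a. of_nat (a - k) * P k))"
  by (subst P.simps) (auto simp: one_pCons)

text \<open>Taking second differences in \<open>a\<close> turns the defining sum into a three-term
  recurrence: the second difference of \<open>a^2\<close> is 2, and that of the weighted sum
  \<open>R\<close> is the single term \<open>P (Suc a)\<close>.\<close>

lemma P_recurrence: "P (Suc (Suc a)) = [:2, -1:] * P (Suc a) - P a + [:0, 2:]"
proof -
  define R where "R a = (\<Sum>k = 1..<a. of_nat (a - k) * P k)" for a
  have R: "R (Suc a) = R a + (\<Sum>k = 1..a. P k)" for a
  proof -
    have "R (Suc a) = (\<Sum>k = 1..a. of_nat (a - k) * P k + P k)"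
      unfolding R_def by (intro sum.cong) (auto simp: Suc_diff_le algebra_simps)
    also have "(\<Sum>k = 1..a. of_nat (a - k) * P k + P k) = (\<Sum>k = 1..a. of_nat (a - k) * P k) + (\<Sum>k = 1..a. P k)"
      by (rule sum.distrib)
    also have "(\<Sum>k = 1..a. of_nat (a - k) * P k) = R a"
      unfolding R_def by (rule sum.mono_neutral_right) auto
    finally show ?thesis .
  qed
  have P: "P a = [:0, 1:] * (of_nat (a\<^sup>2) - R a)" for a unfolding R_def by (rule P_unfold)
  have "P (Suc (Suc a)) - 2 * P (Suc a) + P a =
      [:0, 1:] * (of_nat ((Suc (Suc a))\<^sup>2) - 2 * of_nat ((Suc a)\<^sup>2) + of_nat (a\<^sup>2)
        - (R (Suc (Suc a)) - 2 * R (Suc a) + R a))"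
    unfolding P[of "Suc (Suc a)"] P[of "Suc a"] P[of a] by (simp only: algebra_simps)
  also have "R (Suc (Suc a)) - 2 * R (Suc a) + R a = P (Suc a)"
    unfolding R[of "Suc a"] R[of a] by simp
  also have "of_nat ((Suc (Suc a))\<^sup>2) - 2 * of_nat ((Suc a)\<^sup>2) + of_nat (a\<^sup>2) = (2 :: int poly)"
    by (simp add: power2_eq_square algebra_simps)
  finally have "P (Suc (Suc a)) = 2 * P (Suc a) - P a + [:0, 1:] * (2 - P (Suc a))" by (simp add: algebra_simps)
  also have "\<dots> = (2 - [:0, 1:]) * P (Suc a) - P a + [:0, 1:] * 2" by (simp only: algebra_simps)
  also have "2 - [:0, 1:] = [:2, -1 :: int:]" by (simp add: numeral_poly)
  also have "[:0, 1:] * 2 = [:0, 2 :: int:]" by (simp add: numeral_poly)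
  finally show ?thesis .
qed

lemma P_0 [simp]: "P 0 = 0" and P_1 [simp]: "P (Suc 0) = [:0, 1:]"
  by (simp_all add: P.simps)

lemma coeff_P_0: "coeff (P a) 0 = 0"
  by (subst P_unfold) simp

text \<open>Linear coefficients satisfy the second-order recurrence of the squares. So the linear
  coefficient of \<open>Q\<close> is a sum of squares, which is how \<open>Q\<close> is seen to be
  nonzero.\<close>

lemma coeff_P_1: "coeff (P a) 1 = (int a)\<^sup>2"
proof (induction a rule: induct_nat_012)
  case (ge2 a)
  then show ?case
    by (simp add: P_recurrence coeff_P_0 mult_pCons_left power2_eq_square algebra_simps)
qed simp_all

text \<open>Both sides satisfy the same recurrence in \<open>a\<close>, because
  \<open>2 - (2 - z - w) = z + w\<close> and \<open>z w = 1\<close>.\<close>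

lemma ceval_P:
  assumes "z * w = 1"
  shows "ceval (P a) (2 - z - w) = 2 - z ^ a - w ^ a"
proof (induction a rule: induct_nat_012)
  case (ge2 a)
  let ?t = "2 - z - w"
  have "ceval (P (Suc (Suc a))) ?t = (z + w) * ceval (P (Suc a)) ?t - ceval (P a) ?t + 2 * ?t"
    by (simp add: P_recurrence algebra_simps)
  also have "\<dots> =
      (z + w) * (2 - z * z ^ a - w * w ^ a) - (2 - z ^ a - w ^ a) + 2 * (2 - z - w)"
    unfolding ge2 by simp
  also have "\<dots> = 2 - z ^ Suc (Suc a) - w ^ Suc (Suc a) + (1 - z * w) * (w ^ a + z ^ a)"
    by (simp add: algebra_simps)
  finally show ?case using assms by simp
qed simp_all

section \<open>Laplacian eigenvalues of Cayley-Serre multigraphs of cyclic groups\<close>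

lemma power_int_mod_root:
  assumes "(z :: complex) ^ N = 1" "0 < N"
  shows "z powi (k mod int N) = z powi k"
proof -
  have "z \<noteq> 0" using assms by (auto simp: power_0_left)
  have "z powi k = z powi (int N * (k div int N) + k mod int N)" by simp
  also have "\<dots> = (z powi int N) powi (k div int N) * z powi (k mod int N)"
    by (simp only: power_int_add[OF disjI1, OF \<open>z \<noteq> 0\<close>] power_int_mult)
  finally show ?thesis using assms by simp
qed

definition tower_level :: "nat \<Rightarrow> 's set \<Rightarrow> ('s \<Rightarrow> int) \<Rightarrow> (int, int \<times> 's) multigraph" where
  "tower_level N S i = cayley_serre (integer_mod_group N) S (\<lambda>s. i s mod int N)"

lemma tower_level_simps:
  assumes "0 < N"
  shows "verts (tower_level N S i) = {0..<int N}"
    and "edges (tower_level N S i) = {0..<int N} \<times> S"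
    and "ends (tower_level N S i) (\<sigma>, s) = {\<sigma>, (\<sigma> + i s) mod int N}"
  using assms unfolding tower_level_def cayley_serre_def
  by (simp_all add: carrier_integer_mod_group mult_integer_mod_group mod_simps)

lemma finite_multigraph_tower_level:
  assumes "0 < N" "finite S"
  shows "finite_multigraph (tower_level N S i)"
proof
  show "ends (tower_level N S i) e \<subseteq> verts (tower_level N S i)" if "e \<in> edges (tower_level N S i)" for e
    using that assms(1) by (cases e) (auto simp: tower_level_simps)
  show "\<exists>x y. ends (tower_level N S i) e = {x, y}" for e
    using assms(1) by (cases e) (auto simp: tower_level_simps)
qed (use assms in \<open>auto simp: tower_level_simps\<close>)

text \<open>The characters \<open>v \<mapsto> z^v\<close> are eigenvectors. For each
  \<open>s\<close>, the edge leaving \<open>u\<close> contributes \<open>1 - z^(i s)\<close> and the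
  edge arriving at \<open>u\<close> contributes \<open>1 - z^(-i s)\<close>.\<close>

lemma laplacian_tower_level:
  assumes N: "0 < N" and S: "finite S" and u: "u < N" and z: "(z :: complex) ^ N = 1"
  shows "(\<Sum>v<N. of_int (laplacian (tower_level N S i) ({0..<int N} \<times> S) (int u) (int v)) * z ^ v) =
    (\<Sum>s\<in>S. 2 - z powi i s - z powi (- i s)) * z ^ u"
proof -
  let ?X = "tower_level N S i"
  have nz: "z \<noteq> 0" using N z by (auto simp: power_0_left)
  \<comment> \<open>Row \<open>u\<close> sees the edge \<open>(\<sigma>, s)\<close> only if
    \<open>u\<close> is its start or its end, that is, if \<open>\<sigma>\<close> is
    \<open>u\<close> or \<open>u - i s\<close> modulo \<open>N\<close>. If both hold, the edge is a
    loop and the two terms cancel.\<close>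
  have edge: "(\<Sum>v<N. of_int (edge_form ?X (\<sigma>, s) (int u) (int v)) * z ^ v) =
      (of_bool (\<sigma> = int u) - of_bool (\<sigma> = (int u - i s) mod int N)) * (z powi \<sigma> * (1 - z powi i s))"
    if \<sigma>: "\<sigma> \<in> {0..<int N}" for \<sigma> s
  proof -
    define \<tau> where "\<tau> = (\<sigma> + i s) mod int N"
    have \<tau>: "0 \<le> \<tau>" "\<tau> < int N" using N unfolding \<tau>_def by simp_all
    have "int u = \<tau> \<longleftrightarrow> \<sigma> = (int u - i s) mod int N"
    proof
      assume "int u = \<tau>"
      then have "(int u - i s) mod int N = \<sigma> mod int N" unfolding \<tau>_def by (simp add: mod_simps)
      then show "\<sigma> = (int u - i s) mod int N" using \<sigma> by simp
    next
      assume "\<sigma> = (int u - i s) mod int N"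
      then have "\<tau> = int u mod int N" unfolding \<tau>_def by (simp add: mod_simps)
      then show "int u = \<tau>" using u by simp
    qed
    moreover have "int v = \<sigma> \<longleftrightarrow> v = nat \<sigma>" "int v = \<tau> \<longleftrightarrow> v = nat \<tau>" for v
      using \<sigma> \<tau> by auto
    moreover have "int u = \<sigma> \<longleftrightarrow> \<sigma> = int u" by auto
    ultimately have form: "edge_form ?X (\<sigma>, s) (int u) (int v) =
        (of_bool (\<sigma> = int u) - of_bool (\<sigma> = (int u - i s) mod int N)) * (of_bool (v = nat \<sigma>) - of_bool (v = nat \<tau>))"
      for v
      using edge_form_pair[OF tower_level_simps(3)[OF N], of S i \<sigma> s "int u" "int v", folded \<tau>_def]
      by (simp only:)
    have "(\<Sum>v<N. of_int (edge_form ?X (\<sigma>, s) (int u) (int v)) * z ^ v) =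
        (of_bool (\<sigma> = int u) - of_bool (\<sigma> = (int u - i s) mod int N)) *
        ((\<Sum>v<N. if v = nat \<sigma> then z ^ v else 0) - (\<Sum>v<N. if v = nat \<tau> then z ^ v else 0))"
      unfolding form sum_subtractf[symmetric] sum_distrib_left by (intro sum.cong) auto
    also have "(\<Sum>v<N. if v = nat \<sigma> then z ^ v else 0) = z powi \<sigma>"
      using \<sigma> by (simp add: power_int_def nat_less_iff)
    also have "(\<Sum>v<N. if v = nat \<tau> then z ^ v else 0) = z powi \<tau>"
      using \<tau> by (simp add: power_int_def nat_less_iff)
    also have "\<dots> = z powi \<sigma> * z powi i s"
      unfolding \<tau>_def power_int_mod_root[OF z N] using nz by (simp add: power_int_add)
    finally show ?thesis by (simp add: algebra_simps)
  qed
  have "(\<Sum>v<N. of_int (laplacian ?X ({0..<int N} \<times> S) (int u) (int v)) * z ^ v) =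
      (\<Sum>e\<in>{0..<int N} \<times> S. \<Sum>v<N. of_int (edge_form ?X e (int u) (int v)) * z ^ v)"
    unfolding laplacian_def of_int_sum sum_distrib_right by (rule sum.swap)
  also have "\<dots> = (\<Sum>\<sigma>\<in>{0..<int N}. \<Sum>s\<in>S. \<Sum>v<N. of_int (edge_form ?X (\<sigma>, s) (int u) (int v)) * z ^ v)"
    by (rule sum.cartesian_product')
  also have "\<dots> = (\<Sum>s\<in>S. \<Sum>\<sigma>\<in>{0..<int N}. \<Sum>v<N. of_int (edge_form ?X (\<sigma>, s) (int u) (int v)) * z ^ v)"
    by (rule sum.swap)
  also have "\<dots> = (\<Sum>s\<in>S. (2 - z powi i s - z powi (- i s)) * z ^ u)"
  proof (rule sum.cong[OF refl])
    fix s
    define \<rho> where "\<rho> = (int u - i s) mod int N"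
    have \<rho>: "\<rho> \<in> {0..<int N}" using N unfolding \<rho>_def by simp
    have "(\<Sum>\<sigma>\<in>{0..<int N}. \<Sum>v<N. of_int (edge_form ?X (\<sigma>, s) (int u) (int v)) * z ^ v) =
        (\<Sum>\<sigma>\<in>{0..<int N}. (if \<sigma> = int u then z powi \<sigma> * (1 - z powi i s) else 0) -
          (if \<sigma> = \<rho> then z powi \<sigma> * (1 - z powi i s) else 0))"
      using edge unfolding \<rho>_def by (intro sum.cong) simp_all
    also have "\<dots> = z powi int u * (1 - z powi i s) - z powi \<rho> * (1 - z powi i s)"
      using u \<rho> by (simp add: sum_subtractf)
    also have "z powi \<rho> = z ^ u * z powi (- i s)"
      unfolding \<rho>_def power_int_mod_root[OF z N] using nz
      by (simp add: power_int_diff power_int_minus field_simps)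
    also have "z powi int u * (1 - z powi i s) - z ^ u * z powi (- i s) * (1 - z powi i s) =
        (2 - z powi i s - z powi (- i s)) * z ^ u"
      using nz by (simp add: power_int_minus field_simps)
    finally show "(\<Sum>\<sigma>\<in>{0..<int N}. \<Sum>v<N. of_int (edge_form ?X (\<sigma>, s) (int u) (int v)) * z ^ v) =
        (2 - z powi i s - z powi (- i s)) * z ^ u" .
  qed
  finally show ?thesis by (simp add: sum_distrib_right)
qed

text \<open>Each summand is invariant under changing the sign of \<open>i s\<close>, which is why
  absolute values enter \<open>Q\<close>.\<close>

lemma eigenvalue_eq_ceval:
  assumes "z \<noteq> 0"
  shows "(\<Sum>s\<in>S. 2 - z powi i s - z powi (- i s)) = ceval (\<Sum>s\<in>S. P (nat \<bar>i s\<bar>)) (2 - z - inverse z)"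
proof -
  have "2 - z powi k - z powi (- k) = ceval (P (nat \<bar>k\<bar>)) (2 - z - inverse z)" for k
    using assms ceval_P[of z "inverse z" "nat \<bar>k\<bar>"]
    by (cases "k \<ge> 0") (simp_all add: power_int_def power_inverse)
  then show ?thesis by simp
qed

theorem card_spanning_trees_tower_level:
  assumes N: "0 < N" and S: "finite S"
  shows "of_nat (N * card (spanning_trees (tower_level N S i))) =
    (\<Prod>z | z ^ N = 1 \<and> z \<noteq> 1. ceval (\<Sum>s\<in>S. P (nat \<bar>i s\<bar>)) (2 - z - inverse z))"
proof -
  let ?X = "tower_level N S i"
  let ?L = "rooted_laplacian ?X int (edges ?X) {0}"
  let ?h = "\<lambda>z. \<Sum>s\<in>S. 2 - z powi i s - z powi (- i s)"
  interpret finite_multigraph ?X using finite_multigraph_tower_level[OF assms] .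
  have card: "card (verts ?X) = N" by (simp add: tower_level_simps[OF N])
  have bij: "bij_betw int {..<card (verts ?X)} (verts ?X)"
    unfolding card tower_level_simps[OF N] lessThan_atLeast0
    using bij_betw_def image_int_atLeastLessThan[of 0 N] by (auto simp: inj_on_def)
  have "0 \<in> verts ?X" using N by (simp add: tower_level_simps)
  then have "int (card (spanning_trees ?X)) = det ?L"
    using card_rooted_forests[OF bij, of "edges ?X" "{0}"] spanning_trees_eq[of 0] by simp
  then have "of_nat (card (spanning_trees ?X)) = det (map_mat complex_of_int ?L)"
    by (metis of_int_hom.hom_det of_int_of_nat_eq)
  then have "of_nat (N * card (spanning_trees ?X)) = of_nat N * det (map_mat complex_of_int ?L)" by simp
  also have "\<dots> = (\<Prod>z | z ^ N = 1 \<and> z \<noteq> 1. ?h z)"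
  proof (rule det_reduced_circulant[OF N])
    fix u z assume "0 < u" "u < N" "(z :: complex) ^ N = 1"
    then show "(\<Sum>v<N. map_mat complex_of_int ?L $$ (u, v) * z ^ v) = ?h z * z ^ u"
      using laplacian_tower_level[OF N S, of u z i]
      by (simp add: rooted_laplacian_def card tower_level_simps[OF N])
  qed (use N in \<open>auto simp: rooted_laplacian_def card\<close>)
  also have "\<dots> = (\<Prod>z | z ^ N = 1 \<and> z \<noteq> 1. ceval (\<Sum>s\<in>S. P (nat \<bar>i s\<bar>)) (2 - z - inverse z))"
    using N by (intro prod.cong refl eigenvalue_eq_ceval) (auto simp: power_0_left)
  finally show ?thesis .
qed

text \<open>On the unit circle each summand is \<open>2 - 2 Re z^(i s)\<close>, hence nonnegative.
  For the given \<open>s\<close> it is positive: by Bezout, \<open>z^(i s) = 1\<close> and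
  \<open>z^N = 1\<close> would force \<open>z = 1\<close>.\<close>

lemma eigenvalue_nonzero:
  assumes "finite S" "s \<in> S" "coprime (i s) (int N)" "z ^ N = 1" "z \<noteq> 1" "0 < N"
  shows "ceval (\<Sum>s\<in>S. P (nat \<bar>i s\<bar>)) (2 - z - inverse z) \<noteq> 0"
proof -
  have norm: "norm z = 1" using assms(4,6) power_eq_imp_eq_base[of "norm z" N 1]
    by (simp flip: norm_power)
  then have nz: "z \<noteq> 0" by auto
  have inv: "inverse w = cnj w" if "norm w = 1" for w
    using that complex_norm_square[of w] by (intro inverse_unique) simp
  have re: "Re (2 - z powi k - z powi (- k)) = 2 - 2 * Re (z powi k)" for k
  proof -
    have "z powi (- k) = cnj (z powi k)"
      using norm by (simp add: power_int_minus inv norm_power_int)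
    then have "Re (z powi (- k)) = Re (z powi k)" by (simp only: cnj.sel)
    then show ?thesis by simp
  qed
  have le: "Re (z powi k) \<le> 1" for k
    using complex_Re_le_cmod[of "z powi k"] norm by (simp add: norm_power_int)
  have "Re (z powi i s) \<noteq> 1"
  proof
    assume "Re (z powi i s) = 1"
    moreover have "norm (z powi i s) = 1" using norm by (simp add: norm_power_int)
    ultimately have one: "z powi i s = 1" by (simp add: cmod_def complex_eq_iff)
    obtain x y where xy: "x * i s + y * int N = 1" using bezout_int[of "i s" "int N"] assms(3) by auto
    have "z = z powi (i s * x + int N * y)" using xy by (simp add: mult.commute)
    also have "\<dots> = (z powi i s) powi x * (z powi int N) powi y"
      by (simp only: power_int_add[OF disjI1, OF nz] power_int_mult)
    finally show False using one assms(4,5) by simp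
  qed
  then have "Re (z powi i s) < 1" using le[of "i s"] by linarith
  then have "0 < (\<Sum>s\<in>S. Re (2 - z powi i s - z powi (- i s)))"
    using assms(1,2) le by (intro sum_pos2[of _ s]) (auto simp: re simp del: minus_complex.sel)
  then have "(\<Sum>s\<in>S. 2 - z powi i s - z powi (- i s)) \<noteq> 0"
    by (metis Re_sum less_irrefl zero_complex.sel(1))
  then show ?thesis unfolding eigenvalue_eq_ceval[OF nz, where S = S and i = i] .
qed

section \<open>Primitive roots of unity of prime power order\<close>

lemma ceval_pcompose: "ceval (pcompose F G) z = ceval F (ceval G z)"
  by (induction F) (simp_all add: pcompose_pCons)

lemma ceval_of_nat [simp]: "ceval (of_nat k) z = of_nat k"
  by (simp add: of_nat_poly)

text \<open>For \<open>M = l ^ n\<close> with \<open>l\<close> prime these are the primitive roots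
  of order \<open>l ^ Suc n\<close>.\<close>

definition new_roots :: "nat \<Rightarrow> nat \<Rightarrow> complex set" where
  "new_roots l M = {z. z ^ (l * M) = 1 \<and> z ^ M \<noteq> 1}"

text \<open>This is \<open>(x^(l M) - 1) / (x^M - 1)\<close>, which for \<open>M = l ^ n\<close>
  with \<open>l\<close> prime is the cyclotomic polynomial of order
  \<open>l ^ Suc n\<close>.\<close>

definition cyclotomic :: "nat \<Rightarrow> nat \<Rightarrow> int poly" where
  "cyclotomic l M = (\<Sum>i<l. monom 1 1 ^ (M * i))"

context
  fixes l M :: nat
  assumes l: "1 < l" and M: "0 < M"
begin

lemma roots_split:
  "{z :: complex. z ^ (l * M) = 1} = {z. z ^ M = 1} \<union> new_roots l M"
  "{z :: complex. z ^ M = 1} \<inter> new_roots l M = {}"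
  "finite (new_roots l M)"
  using M l finite_roots_unity[of "l * M", where ?'a = complex] unfolding new_roots_def
  by (auto simp: power_mult mult.commute[of l])

lemma finite_roots: "finite {z :: complex. z ^ M = 1}"
  using M by (simp add: finite_roots_unity)

lemma card_new_roots: "card (new_roots l M) = (l - 1) * M"
proof -
  have "l * M = M + card (new_roots l M)"
    using card_Un_disjoint[OF finite_roots roots_split(3,2)] roots_split(1)
      card_roots_unity_eq[of M] card_roots_unity_eq[of "l * M"] M l by simp
  then show ?thesis by (simp add: diff_mult_distrib)
qed

lemma prod_roots_split:
  "(\<Prod>z | z ^ (l * M) = 1. h z) = (\<Prod>z | z ^ M = 1. h z) * (\<Prod>z\<in>new_roots l M. h (z :: complex))"
  unfolding roots_split(1) by (rule prod.union_disjoint[OF finite_roots roots_split(3,2)])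

lemma prod_nontrivial_roots_split:
  "(\<Prod>z | z ^ (l * M) = 1 \<and> z \<noteq> 1. h z) =
    (\<Prod>z | z ^ M = 1 \<and> z \<noteq> 1. h z) * (\<Prod>z\<in>new_roots l M. h (z :: complex))"
proof -
  have one: "1 \<notin> new_roots l M" unfolding new_roots_def by simp
  have diff: "{z :: complex. z ^ k = 1 \<and> z \<noteq> 1} = {z. z ^ k = 1} - {1}" for k by blast
  have "{z :: complex. z ^ (l * M) = 1} - {1} = ({z. z ^ M = 1} - {1}) \<union> new_roots l M"
    unfolding roots_split(1) Un_Diff using one by simp
  moreover have "({z :: complex. z ^ M = 1} - {1}) \<inter> new_roots l M = {}" using roots_split(2) by blast
  ultimately show ?thesis
    unfolding diff using prod.union_disjoint[OF finite_Diff[OF finite_roots] roots_split(3)] by simp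
qed

lemma ceval_cyclotomic: "ceval (cyclotomic l M) z = (\<Sum>i<l. (z ^ M) ^ i)"
  unfolding cyclotomic_def by (simp add: power_mult)

lemma ceval_cyclotomic_new_root: "z \<in> new_roots l M \<Longrightarrow> ceval (cyclotomic l M) z = 0"
  unfolding ceval_cyclotomic
  by (rule sum_powers_root) (auto simp: new_roots_def power_mult[symmetric] mult.commute)

text \<open>The monic polynomial with the new roots as zeros is
  \<open>1 + x^M + ... + x^((l-1) M)\<close>, whose value at 1 is \<open>l\<close>.\<close>

lemma prod_one_minus_new_roots: "(\<Prod>z\<in>new_roots l M. 1 - z) = of_nat l"
proof -
  let ?p = "\<Prod>z\<in>new_roots l M. [:-z, 1:]"
  let ?q = "\<Sum>i<l. monom (1 :: complex) (M * i)"
  let ?d = "(l - 1) * M"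
  have "degree ?p = ?d"
    by (subst degree_prod_eq_sum_degree) (auto simp: card_new_roots)
  moreover have "lead_coeff ?p = 1" by (simp add: lead_coeff_prod)
  moreover have "?q = (\<Sum>i<l - 1. monom 1 (M * i)) + monom 1 ?d"
    using l by (cases l) (simp_all add: mult.commute)
  moreover have "coeff (\<Sum>i<l - 1. monom (1 :: complex) (M * i)) k = 0" if "k \<ge> ?d" for k
    unfolding coeff_sum using that M
    by (intro sum.neutral) (auto simp: mult.commute)
  then have "coeff ?q ?d = 1" "degree ?q \<le> ?d"
    unfolding calculation(3) by (auto intro!: degree_le)
  moreover have "poly ?p z = poly ?q z" if z: "z \<in> new_roots l M" for z
  proof -
    have "poly ?p z = 0" using z roots_split(3) by (auto simp: poly_prod)
    moreover have "poly ?q z = 0"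
      using ceval_cyclotomic_new_root[OF z] unfolding ceval_cyclotomic
      by (simp add: poly_sum poly_monom power_mult)
    ultimately show ?thesis by simp
  qed
  ultimately have "?p = ?q"
    by (intro poly_eqI_degree_lead_coeff[where A = "new_roots l M" and n = ?d])
      (simp_all only: card_new_roots order_refl)
  then have "poly ?p 1 = poly ?q 1" by simp
  then show ?thesis by (simp add: poly_prod poly_sum poly_monom)
qed

text \<open>Here \<open>2 - z - 1/z = (1 - z) (1 - 1/z)\<close>, and inversion permutes the new
  roots.\<close>

lemma prod_eigenvalue_new_roots: "(\<Prod>z\<in>new_roots l M. 2 - z - inverse z) = (of_nat l)\<^sup>2"
proof -
  have nz: "z \<noteq> 0" if "z \<in> new_roots l M" for z
    using that l M unfolding new_roots_def by (auto simp: power_0_left)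
  have "(\<Prod>z\<in>new_roots l M. 2 - z - inverse z) = (\<Prod>z\<in>new_roots l M. (1 - z) * (1 - inverse z))"
    using nz by (intro prod.cong) (auto simp: field_simps)
  also have "\<dots> = of_nat l * (\<Prod>z\<in>new_roots l M. 1 - inverse z)"
    by (simp add: prod.distrib prod_one_minus_new_roots)
  also have "(\<Prod>z\<in>new_roots l M. 1 - inverse z) = (\<Prod>z\<in>new_roots l M. 1 - z)"
    by (rule prod.reindex_bij_witness[of _ inverse inverse]) (auto simp: new_roots_def power_inverse)
  finally show ?thesis by (simp add: prod_one_minus_new_roots power2_eq_square)
qed

end

text \<open>At a root of \<open>cyclotomic l (l ^ n)\<close> this expresses \<open>l\<close>, up to a factor that is a unit at \<open>l\<close>, as
  a power of \<open>z - 1\<close>.\<close>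

lemma cyclotomic_totally_ramified:
  assumes "prime l"
  obtains H where "(monom 1 1 - 1) ^ ((l - 1) * l ^ n) = cyclotomic l (l ^ n) - of_nat l * H"
    and "poly H 1 = (1 :: int)"
proof -
  let ?y = "monom (1 :: int) 1 - 1" and ?M = "l ^ n"
  let ?C = "cyclotomic l ?M"
  have l: "1 < l" using assms by (rule prime_gt_1_nat)
  have C: "(monom 1 1 ^ ?M - 1) * ?C = monom 1 1 ^ (l * ?M) - 1"
    unfolding cyclotomic_def power_mult mult.commute[of l]
    using power_diff_1_eq[of "monom (1 :: int) 1 ^ ?M" l] by simp
  \<comment> \<open>Modulo \<open>l\<close>, \<open>y^(l M)\<close> is
    \<open>x^(l M) - 1 = (x^M - 1) C\<close>, which is \<open>y^M C\<close>. Since \<open>l\<close>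
    is prime in the polynomial ring and does not divide \<open>y\<close>, the factor
    \<open>y^M\<close> can be cancelled.\<close>
  have "of_nat l dvd ?y ^ ?M - (monom 1 1 ^ ?M - 1)"
    using prime_dvd_freshman_diff[OF assms, of "monom 1 1" "1 :: int poly" n] by simp
  then have "of_nat l dvd (?y ^ ?M - (monom 1 1 ^ ?M - 1)) * ?C" by (rule dvd_mult2)
  moreover have "of_nat l dvd ?y ^ (l * ?M) - (monom 1 1 ^ (l * ?M) - 1)"
    using prime_dvd_freshman_diff[OF assms, of "monom 1 1" "1 :: int poly" "Suc n"] by simp
  ultimately have "of_nat l dvd ?y ^ (l * ?M) - (monom 1 1 ^ (l * ?M) - 1) - (?y ^ ?M - (monom 1 1 ^ ?M - 1)) * ?C"
    using dvd_diff by blast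
  also have "\<dots> = ?y ^ (l * ?M) - ?y ^ ?M * ?C"
    unfolding C[symmetric] by (simp add: algebra_simps)
  also have "l * ?M = ?M + (l - 1) * ?M" using l by (simp add: diff_mult_distrib)
  also have "?y ^ (?M + (l - 1) * ?M) - ?y ^ ?M * ?C = ?y ^ ?M * (?y ^ ((l - 1) * ?M) - ?C)"
    by (simp add: power_add algebra_simps)
  finally have dvd: "[:int l:] dvd ?y ^ ?M * (?y ^ ((l - 1) * ?M) - ?C)" by (simp add: of_nat_poly)
  have prime: "prime_elem [:int l:]" using assms by (simp add: prime_elem_const_poly_iff)
  have "\<not> [:int l:] dvd ?y"
  proof
    assume "[:int l:] dvd ?y"
    then have "int l dvd coeff ?y 1" by (simp only: const_poly_dvd_iff)
    then show False using l by simp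
  qed
  then have "[:int l:] dvd ?y ^ ((l - 1) * ?M) - ?C"
    using dvd prime prime_elem_dvd_mult_iff prime_elem_dvd_power by blast
  then obtain K where K: "?y ^ ((l - 1) * ?M) - ?C = [:int l:] * K" by blast
  have eq: "?y ^ ((l - 1) * ?M) = ?C - of_nat l * (- K)" using K by (simp add: of_nat_poly algebra_simps)
  \<comment> \<open>Evaluation at 1 gives \<open>0 = l - l H(1)\<close>, so
    \<open>H(1) = 1\<close>.\<close>
  have "poly (?y ^ ((l - 1) * ?M)) 1 = 0" using l by (simp add: poly_monom)
  moreover have "poly ?C 1 = int l" unfolding cyclotomic_def by (simp add: poly_sum poly_monom)
  moreover have "poly (?y ^ ((l - 1) * ?M)) 1 = poly ?C 1 - int l * poly (- K) 1" by (subst eq) simp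
  ultimately have "int l * (1 - poly (- K) 1) = 0" by (simp only: right_diff_distrib)
  then have "poly (- K) 1 = 1" using l by simp
  then show thesis using eq that by blast
qed

text \<open>The passage from \<open>A\<close> to \<open>B\<close> multiplies by the values of
  \<open>Q\<close> at the new roots. Multiplied by \<open>H\<close>, each of them becomes
  \<open>l^m t^j0 F(z)\<close> with \<open>t = 2 - z - 1/z\<close> and \<open>F(1)\<close> prime to
  \<open>l\<close>. The numbers \<open>u\<close> and \<open>v\<close> are products of cyclic norms
  of \<open>F\<close> and \<open>H\<close>, so they are prime to \<open>l\<close>.\<close>

theorem norm_step:
  fixes Q :: "int poly" and A B :: int
  assumes l: "prime l"
    and content: "\<And>j. int l ^ m dvd coeff Q j"
    and low: "\<And>j. j < j0 \<Longrightarrow> int l ^ Suc m dvd coeff Q j"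
    and top: "\<not> int l ^ Suc m dvd coeff Q j0"
    and large: "2 * j0 < (l - 1) * l ^ n"
    and A: "of_int A = (\<Prod>z | z ^ (l ^ n) = 1 \<and> z \<noteq> 1. ceval Q (2 - z - inverse z))"
    and B: "of_int B = (\<Prod>z | z ^ (l ^ Suc n) = 1 \<and> z \<noteq> 1. ceval Q (2 - z - inverse z))"
  shows "\<exists>u v. \<not> int l dvd u \<and> \<not> int l dvd v \<and>
    B * u = A * int l ^ (m * ((l - 1) * l ^ n) + 2 * j0) * v"
proof -
  let ?M = "l ^ n" and ?Z = "new_roots l (l ^ n)"
  let ?N = "l * ?M" and ?\<phi> = "(l - 1) * ?M"
  have l1: "1 < l" using l by (rule prime_gt_1_nat)
  then have M: "0 < ?M" and N: "0 < ?N" by simp_all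
  have "[:int l ^ m:] dvd Q" using content unfolding const_poly_dvd_iff by blast
  then obtain R where "Q = [:int l ^ m:] * R" by blast
  then have R: "Q = Polynomial.smult (int l ^ m) R" by simp
  have lowR: "int l dvd coeff R j" if "j < j0" for j using low[OF that] l1 unfolding R by simp
  have topR: "\<not> int l dvd coeff R j0" using top l1 unfolding R by simp
  \<comment> \<open>Split \<open>R = l C + x^j0 B0\<close>, where the constant term of
    \<open>B0\<close> is the coefficient of \<open>R\<close> that is prime to
    \<open>l\<close>.\<close>
  have "[:int l:] dvd poly_cutoff j0 R"
    unfolding const_poly_dvd_iff using lowR by (simp add: coeff_poly_cutoff)
  then obtain C where C: "poly_cutoff j0 R = [:int l:] * C" by blast
  define B0 where "B0 = poly_shift j0 R"
  have RC: "R = of_nat l * C + monom 1 1 ^ j0 * B0"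
  proof -
    have "R = poly_cutoff j0 R + monom 1 j0 * B0"
      unfolding B0_def by (intro poly_eqI) (simp add: coeff_poly_cutoff coeff_poly_shift coeff_monom_mult)
    then show ?thesis by (simp add: C of_nat_poly monom_altdef)
  qed
  obtain H where H: "(monom 1 1 - 1) ^ ?\<phi> = cyclotomic l ?M - of_nat l * H" "poly H 1 = (1 :: int)"
    using cyclotomic_totally_ramified[OF l] .
  \<comment> \<open>At an \<open>N\<close>-th root of unity \<open>z^(N-1)\<close> is
    \<open>1/z\<close>, so \<open>T\<close> is a genuine polynomial with value
    \<open>2 - z - 1/z\<close>.\<close>
  define T where "T = [:2 :: int:] - monom 1 1 - monom 1 (?N - 1)"
  \<comment> \<open>\<open>F\<close> is what remains of \<open>H R(T)\<close> after replacing
    \<open>l H\<close> by \<open>-(x - 1)^\<phi>\<close> and extracting \<open>T^j0\<close>, with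
    \<open>(x - 1)^2 = -x T\<close> at the roots.\<close>
  define F where "F = H * pcompose B0 T
    - (monom 1 1 - 1) ^ (?\<phi> - 2 * j0) * (- monom 1 1) ^ j0 * pcompose C T"
  have T1: "poly T 1 = 0" unfolding T_def by (simp add: poly_monom)
  \<comment> \<open>The strict inequality in \<open>large\<close> leaves a positive power of
    \<open>x - 1\<close>, so the second summand vanishes at 1, and \<open>T(1) = 0\<close> reduces
    the first to the constant term of \<open>B0\<close>.\<close>
  have "poly F 1 = coeff R j0"
    using large unfolding F_def B0_def
    by (simp add: poly_pcompose T1 H(2) poly_monom poly_0_coeff_0 coeff_poly_shift)
  then have F1: "\<not> int l dvd poly F 1" using topR by simp
  have H1: "\<not> int l dvd poly H 1" using H(2) l1 by simp
  have key: "ceval H z * ceval Q (2 - z - inverse z) =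
      of_nat l ^ m * (2 - z - inverse z) ^ j0 * ceval F z" if z: "z \<in> ?Z" for z
  proof -
    have zN: "z ^ ?N = 1" using z unfolding new_roots_def by simp
    then have nz: "z \<noteq> 0" using N by (auto simp: power_0_left)
    let ?t = "2 - z - inverse z"
    have "z * z ^ (?N - 1) = 1" using zN N by (metis power_eq_if not_gr_zero)
    then have t: "ceval T z = ?t" unfolding T_def by (simp add: inverse_unique)
    have sq: "(z - 1)\<^sup>2 = - z * ?t" using nz by (simp add: power2_eq_square field_simps)
    have "(z - 1) ^ ?\<phi> = (z - 1) ^ (?\<phi> - 2 * j0) * ((z - 1)\<^sup>2) ^ j0"
      using large by (simp flip: power_add power_mult)
    then have pow: "(z - 1) ^ ?\<phi> = (z - 1) ^ (?\<phi> - 2 * j0) * (- z) ^ j0 * ?t ^ j0"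
      unfolding sq power_mult_distrib by simp
    have lH: "of_nat l * ceval H z = - ((z - 1) ^ ?\<phi>)"
      using arg_cong[OF H(1), of "\<lambda>p. ceval p z"] ceval_cyclotomic_new_root[OF l1 M z] by simp
    have "ceval H z * ceval Q ?t =
        of_nat l ^ m * ((of_nat l * ceval H z) * ceval C ?t + ?t ^ j0 * (ceval H z * ceval B0 ?t))"
      unfolding R by (subst RC) (simp add: algebra_simps)
    also have "\<dots> = of_nat l ^ m * ?t ^ j0 * ceval F z"
      unfolding lH pow F_def by (simp add: ceval_pcompose t algebra_simps)
    finally show ?thesis .
  qed
  let ?E = "\<lambda>G. \<Prod>z\<in>?Z. G z"
  have "?E (ceval H) * ?E (\<lambda>z. ceval Q (2 - z - inverse z)) =
      (\<Prod>z\<in>?Z. of_nat l ^ m * (2 - z - inverse z) ^ j0 * ceval F z)"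
    using key by (simp flip: prod.distrib)
  also have "\<dots> = of_nat l ^ (m * ?\<phi>) * (?E (\<lambda>z. 2 - z - inverse z)) ^ j0 * ?E (ceval F)"
    by (simp add: prod.distrib card_new_roots[OF l1 M] power_mult prod_power_distrib)
  also have "?E (\<lambda>z. 2 - z - inverse z) ^ j0 = of_nat l ^ (2 * j0)"
    unfolding prod_eigenvalue_new_roots[OF l1 M] by (simp add: power_mult)
  finally have E: "?E (ceval H) * ?E (\<lambda>z. ceval Q (2 - z - inverse z)) =
      of_nat l ^ (m * ?\<phi> + 2 * j0) * ?E (ceval F)" by (simp add: power_add)
  \<comment> \<open>The product over the new roots is the quotient of two cyclic norms; the relation
    is kept multiplicative so that everything can be compared in the integers.\<close>
  have cn: "of_int (cyclic_norm ?N G) = of_int (cyclic_norm ?M G) * ?E (ceval G)" for G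
    unfolding of_int_cyclic_norm[OF N] of_int_cyclic_norm[OF M] by (rule prod_roots_split[OF l1 M])
  have BA: "of_int B = of_int A * ?E (\<lambda>z. ceval Q (2 - z - inverse z))"
    unfolding A B power_Suc by (rule prod_nontrivial_roots_split[OF l1 M])
  have "complex_of_int (B * (cyclic_norm ?N H * cyclic_norm ?M F)) =
      of_int A * (?E (ceval H) * ?E (\<lambda>z. ceval Q (2 - z - inverse z)))
        * (of_int (cyclic_norm ?M H) * of_int (cyclic_norm ?M F))"
    by (simp add: BA cn)
  also have "\<dots> = of_int A * of_nat l ^ (m * ?\<phi> + 2 * j0) * (of_int (cyclic_norm ?M H) * of_int (cyclic_norm ?N F))"
    unfolding E by (simp add: cn[of F])
  also have "\<dots> = complex_of_int (A * int l ^ (m * ?\<phi> + 2 * j0) * (cyclic_norm ?M H * cyclic_norm ?N F))" by simp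
  finally have "B * (cyclic_norm ?N H * cyclic_norm ?M F) =
      A * int l ^ (m * ?\<phi> + 2 * j0) * (cyclic_norm ?M H * cyclic_norm ?N F)"
    by (simp only: of_int_eq_iff)
  moreover have "\<not> int l dvd cyclic_norm ?N G * cyclic_norm ?M G'" "\<not> int l dvd cyclic_norm ?M G' * cyclic_norm ?N G"
    if "\<not> int l dvd poly G 1" "\<not> int l dvd poly G' 1" for G G'
    using cyclic_norm_not_dvd[OF l that(1), of "Suc n"] cyclic_norm_not_dvd[OF l that(2), of n] l
    by (simp_all add: prime_dvd_mult_iff)
  ultimately show ?thesis using F1 H1 by blast
qed

section \<open>Growth of the number of spanning trees\<close>

lemma multiplicity_step:
  fixes A B u v :: int
  assumes l: "prime l" and nz: "A \<noteq> 0" "B \<noteq> 0" and unit: "\<not> int l dvd u" "\<not> int l dvd v"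
    and eq: "B * u = A * int l ^ k * v"
  shows "multiplicity (int l) B = multiplicity (int l) A + k"
proof -
  have p: "prime_elem (int l)" using l by simp
  have uv: "u \<noteq> 0" "v \<noteq> 0" using unit by auto
  have l0: "int l \<noteq> 0" "\<not> is_unit (int l)" using p by auto
  have "multiplicity (int l) (B * u) = multiplicity (int l) B"
    using nz uv unit p by (simp add: prime_elem_multiplicity_mult_distrib not_dvd_imp_multiplicity_0)
  moreover have "multiplicity (int l) (A * int l ^ k * v) = multiplicity (int l) A + k"
    using nz uv unit p l0
    by (simp add: prime_elem_multiplicity_mult_distrib not_dvd_imp_multiplicity_0 multiplicity_same_power)
  ultimately show ?thesis using eq by simp
qed

theorem theorem5p6:
  fixes l q t :: nat and S :: "int set" and i :: "int \<Rightarrow> int"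
  assumes "prime l"
    and "q \<ge> 2" and "odd q"
    and "t = (q + 1) div 2"
    and "finite S" and "card S = t"
    and "\<exists>s\<in>S. coprime (i s) (int l)"
  defines "X \<equiv> \<lambda>n. cayley_serre (integer_mod_group (l ^ n)) S (\<lambda>s. i s mod int (l ^ n))"
  defines "\<kappa> \<equiv> \<lambda>n. card (spanning_trees (X n))"
  defines "Q \<equiv> \<Sum>s\<in>S. P (nat \<bar>i s\<bar>)"
  defines "a \<equiv> degree Q"
  defines "c \<equiv> \<lambda>j. coeff Q j"
  defines "\<mu> \<equiv> Min {ord_at l (c j) | j. j \<in> {1..a}}"
  defines "lam \<equiv> int (Min {2 * j | j. j \<in> {1..a} \<and> ord_at l (c j) = \<mu>}) - 1"
  shows "\<exists>n\<^sub>0 \<ge> 1. \<exists>\<nu> :: int. \<forall>n \<ge> n\<^sub>0.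
           ord_at l (int (\<kappa> n)) =
             \<mu> * ereal (real (l ^ n)) + ereal (real_of_int (lam * int n)) + ereal (real_of_int \<nu>)"
proof -
  have l1: "1 < l" using assms(1) by (rule prime_gt_1_nat)
  have p: "prime_elem (int l)" using assms(1) by simp
  have unit: "\<not> is_unit (int l)" using l1 by simp
  obtain s where s: "s \<in> S" "coprime (i s) (int l)" using assms(7) by blast
  have "i s \<noteq> 0" using s(2) unit by auto
  \<comment> \<open>A nonzero \<open>c 1\<close> makes the index set nonempty and the minimum
    \<open>\<mu>\<close> finite.\<close>
  then have "0 < (\<Sum>s\<in>S. (i s)\<^sup>2)" using assms(5) s(1) by (intro sum_pos2[of S s]) auto
  moreover have "c 1 = (\<Sum>s\<in>S. (i s)\<^sup>2)" unfolding c_def Q_def coeff_sum coeff_P_1 by simp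
  ultimately have c1: "c 1 \<noteq> 0" by simp
  then have a1: "1 \<in> {1..a}" using le_degree[of Q 1] unfolding c_def a_def by simp
  have c0: "c 0 = 0" unfolding c_def Q_def coeff_sum by (simp add: coeff_P_0)

  let ?O = "{ord_at l (c j) | j. j \<in> {1..a}}"
  have finO: "finite ?O" by simp
  have le: "\<mu> \<le> ord_at l (c j)" if "j \<in> {1..a}" for j
    unfolding \<mu>_def using that by (intro Min_le[OF finO]) blast
  have "\<mu> \<in> ?O" unfolding \<mu>_def using a1 by (intro Min_in[OF finO]) blast
  then obtain j1 where j1: "j1 \<in> {1..a}" "\<mu> = ord_at l (c j1)" by blast
  have "\<mu> \<noteq> \<infinity>" using le[OF a1] c1 unfolding ord_at_def by auto
  then obtain m where m: "\<mu> = ereal (real m)" using j1(2) unfolding ord_at_def by (metis (full_types))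
  let ?J = "{2 * j | j. j \<in> {1..a} \<and> ord_at l (c j) = \<mu>}"
  have finJ: "finite ?J" by simp
  have "Min ?J \<in> ?J" using j1 by (intro Min_in[OF finJ]) blast
  \<comment> \<open>\<open>j0\<close> is the first index at which the minimal valuation is attained;
    earlier coefficients have valuation at least \<open>m + 1\<close>.\<close>
  then obtain j0 where j0: "Min ?J = 2 * j0" "j0 \<in> {1..a}" "ord_at l (c j0) = \<mu>" by blast
  have lam: "lam = 2 * int j0 - 1" unfolding lam_def j0(1) by simp
  have out: "c j = 0" if "j \<notin> {1..a}" for j
    using that c0 coeff_eq_0[of Q j] unfolding c_def a_def by (cases "j = 0") auto
  have dvd: "int l ^ k dvd c j" if "c j \<noteq> 0 \<Longrightarrow> ereal (real k) \<le> ord_at l (c j)" for j k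
    using that by (cases "c j = 0") (auto simp: ord_at_def intro: multiplicity_dvd')
  have content: "int l ^ m dvd coeff Q j" for j
    using dvd[of j m] le[of j] out[of j] m unfolding c_def by auto
  have low: "int l ^ Suc m dvd coeff Q j" if "j < j0" for j
  proof -
    have "ereal (real (Suc m)) \<le> ord_at l (c j)" if nz: "c j \<noteq> 0"
    proof -
      have j: "j \<in> {1..a}" using out nz by blast
      have "ord_at l (c j) \<noteq> \<mu>"
      proof
        assume "ord_at l (c j) = \<mu>"
        then have "Min ?J \<le> 2 * j" using j by (intro Min_le[OF finJ]) blast
        then show False using \<open>j < j0\<close> j0(1) by simp
      qed
      then show ?thesis using le[OF j] nz m unfolding ord_at_def by auto
    qed
    then show ?thesis using dvd[of j "Suc m"] unfolding c_def by blast
  qed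
  have top: "\<not> int l ^ Suc m dvd coeff Q j0"
  proof -
    have "c j0 \<noteq> 0" "multiplicity (int l) (c j0) = m"
      using j0(3) m unfolding ord_at_def by (auto split: if_splits)
    then show ?thesis using unit unfolding c_def
      by (subst power_dvd_iff_le_multiplicity) simp_all
  qed

  have norm: "complex_of_int (int (l ^ n * \<kappa> n)) = (\<Prod>z | z ^ (l ^ n) = 1 \<and> z \<noteq> 1. ceval Q (2 - z - inverse z))"
    for n
    using card_spanning_trees_tower_level[of "l ^ n" S i] l1 assms(5)
    unfolding \<kappa>_def X_def Q_def tower_level_def by simp
  have nz: "\<kappa> n \<noteq> 0" for n
  proof
    assume "\<kappa> n = 0"
    moreover have "finite {z :: complex. z ^ (l ^ n) = 1 \<and> z \<noteq> 1}"
      using finite_roots_unity[of "l ^ n", where ?'a = complex] l1 by simp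
    moreover have "ceval Q (2 - z - inverse z) \<noteq> 0" if "z ^ (l ^ n) = 1" "z \<noteq> 1" for z
      unfolding Q_def using that s l1 assms(5) by (intro eigenvalue_nonzero[of S s i "l ^ n"]) auto
    ultimately show False using norm[of n] by auto
  qed
  define g where "g n = multiplicity (int l) (int (\<kappa> n))" for n
  have g: "multiplicity (int l) (int (l ^ n * \<kappa> n)) = n + g n" for n
    using nz[of n] p unit l1 unfolding g_def
    by (simp add: prime_elem_multiplicity_mult_distrib multiplicity_same_power)
  \<comment> \<open>The product over the roots is \<open>l^n \<kappa> n\<close>, whence the summands
    \<open>Suc n\<close> and \<open>n\<close>. Their difference is the source of the
    \<open>- 1\<close> in \<open>lam\<close>.\<close>
  have g_step: "Suc n + g (Suc n) = n + g n + (m * ((l - 1) * l ^ n) + 2 * j0)" if n: "2 * j0 \<le> n" for n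
  proof -
    \<comment> \<open>Exponential growth turns \<open>2 * j0 \<le> n\<close> into the inequality
      \<open>large\<close> of \<open>norm_step\<close>.\<close>
    have "n < l ^ n" using l1 by (intro less_exp[THEN less_le_trans] power_mono) auto
    also have "\<dots> \<le> (l - 1) * l ^ n" using l1 by simp
    finally have "2 * j0 < (l - 1) * l ^ n" using n by simp
    from norm_step[OF assms(1) content low top this norm norm]
    obtain u v where uv: "\<not> int l dvd u" "\<not> int l dvd v"
      "int (l ^ Suc n * \<kappa> (Suc n)) * u = int (l ^ n * \<kappa> n) * int l ^ (m * ((l - 1) * l ^ n) + 2 * j0) * v"
      by blast
    show ?thesis
      using multiplicity_step[OF assms(1) _ _ uv] nz[of n] nz[of "Suc n"] l1 unfolding g by simp
  qed
  define n0 where "n0 = Suc (2 * j0)"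
  \<comment> \<open>Chosen so that the formula holds at \<open>n0\<close>. From there the increments
    \<open>m (l - 1) l^n\<close> and \<open>2 j0 - 1\<close> telescope to the terms in
    \<open>l^n\<close> and \<open>n\<close>.\<close>
  define \<nu> where "\<nu> = int (g n0) - int m * int l ^ n0 - lam * int n0"
  have g_eq: "int (g n) = int m * int l ^ n + lam * int n + \<nu>" if "n0 \<le> n" for n
    using that
  proof (induction n rule: dec_induct)
    case base
    then show ?case unfolding \<nu>_def by simp
  next
    case (step n)
    have "int (Suc n + g (Suc n)) = int (n + g n + (m * ((l - 1) * l ^ n) + 2 * j0))"
      using g_step[of n] \<open>n0 \<le> n\<close> unfolding n0_def by (metis Suc_leD)
    moreover have "int (m * ((l - 1) * l ^ n)) = int m * ((int l - 1) * int l ^ n)"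
      using l1 by (simp add: of_nat_diff)
    ultimately have "1 + int (g (Suc n)) = int (g n) + int m * ((int l - 1) * int l ^ n) + 2 * int j0"
      by (simp only: of_nat_add of_nat_Suc of_nat_mult of_nat_numeral)
    then show ?case using step.IH unfolding lam by (simp add: algebra_simps)
  qed
  have "ord_at l (int (\<kappa> n)) =
      \<mu> * ereal (real (l ^ n)) + ereal (real_of_int (lam * int n)) + ereal (real_of_int \<nu>)" if "n0 \<le> n" for n
  proof -
    have "real (g n) = real m * real l ^ n + real_of_int (lam * int n) + real_of_int \<nu>"
      using arg_cong[OF g_eq[OF that], of real_of_int] by simp
    then show ?thesis using nz[of n] unfolding ord_at_def m g_def by simp
  qed
  moreover have "1 \<le> n0" unfolding n0_def by simp
  ultimately show ?thesis by blast
qed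

end
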